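(* Let $\mathcal C_1,\mathcal C_2:\mathbb R^d\to\mathbb R^d$ be a $\delta_1$-approximate and a $\delta_2$-approximate compressor with $\delta_1\in(0,1]$, $\delta_2\in[0,1]$, let $H>0$ be the (integer) synchronization interval and $\beta\in[0,1)$ the momentum parameter. Assume the smoothness, gradient and global minimum assumptions stated in the context, with constants $L$, $V_1$, $V_1'$, $V_2=V_1+V_1'$ and global minimum $x_*$. Let $(x_{i,t})$ be the iterates of M-CSER with step size $\eta\le\min\{\frac12,\frac{1-\beta}{2L}\}$, and let $\bar x_t=\frac1n\sum_{i\in[n]}x_{i,t}$. Then after $T$ iterations $$\frac1T\sum_{t=1}^T\mathbb E\big[\|\nabla F(\bar x_{t-1})\|^2\big]\le \frac{2(1-\beta)[F(\bar x_0)-F(x_* )]}{\eta T}+\frac{\eta^2\beta^4L^2V_2}{(1-\beta)^4}+\frac{\eta LV_1}{n(1-\beta)}+\left(\frac{1-\delta_1}{(1-\sqrt{1-\delta_1})^2}+1\right)\frac{2(1-\delta_2)\eta^2H^2L^2V_2}{(1-\beta)^2}$$ $$\le \frac{2(1-\beta)[F(\bar x_0)-F(x_* )]}{\eta T}+\frac{\eta^2\beta^4L^2V_2}{(1-\beta)^4}+\frac{\eta LV_1}{n(1-\beta)}+\left(\frac{4(1-\delta_1)}{\delta_1^2}+1\right)\frac{2(1-\delta_2)\eta^2H^2L^2V_2}{(1-\beta)^2}.$$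
   Context: Notation: $[n]=\{1,\dots,n\}$, where $n$ is the number of workers; $\|\cdot\|$ is the Euclidean norm on $\mathbb R^d$. Problem: minimize $F(x)=\frac1n\sum_{i\in[n]}F_i(x)$ over $x\in\mathbb R^d$, where $F_i(x)=\mathbb E_{z_i\sim\mathcal D_i}f(x;z_i)$ and $z_i$ is sampled from the local data $\mathcal D_i$ of worker $i$; it is assumed that $\mathcal D_i\ne\mathcal D_j$ for $i\ne j$. $\nabla f(x;z)$ is the gradient in $x$. Compressor: $\mathcal C:\mathbb R^d\to\mathbb R^d$ is a $\delta$-approximate compressor, $\delta\in[0,1]$, if $\|\mathcal C(v)-v\|^2\le(1-\delta)\|v\|^2$ for all $v\in\mathbb R^d$. Partial synchronization: given vectors $v_1,\dots,v_n\in\mathbb R^d$ held by the $n$ workers, $\mathrm{PSync}(v_i,\mathcal C)$ returns to worker $i$ the pair $(v_i',r_i)$ with $r_i=v_i-\mathcal C(v_i)$ and $v_i'=\frac1n\sum_{k\in[n]}\mathcal C(v_k)+r_i$. M-CSER algorithm (step size $\eta>0$): initialize $x_{i,0}=\hat x_0\in\mathbb R^d$ (the same for all $i$), $e_{i,0}=0$, $m_{i,0}=0$. For $t=1,\dots,T$ and every worker $i\in[n]$: sample $z_{i,t}\sim\mathcal D_i$ and set $g_{i,t}=\nabla f(x_{i,t-1};z_{i,t})$; $m_{i,t}=\beta m_{i,t-1}+g_{i,t}$; $p_{i,t}=\eta(\beta m_{i,t}+g_{i,t})$; $(p'_{i,t},r_{i,t})=\mathrm{PSync}(p_{i,t},\mathcal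 C_2)$; $x_{i,t-\frac12}=x_{i,t-1}-p'_{i,t}$; $e_{i,t-\frac12}=e_{i,t-1}-r_{i,t}$. If $H\nmid t$: $x_{i,t}=x_{i,t-\frac12}$, $e_{i,t}=e_{i,t-\frac12}$. If $H\mid t$: $(e'_{i,t-\frac12},e_{i,t})=\mathrm{PSync}(e_{i,t-\frac12},\mathcal C_1)$ and $x_{i,t}=x_{i,t-\frac12}-e_{i,t-\frac12}+e'_{i,t-\frac12}$. Smoothness assumption: each $F_i$, $i\in[n]$, is $L$-smooth, meaning $F_i(y)-F_i(x)\le\langle\nabla F_i(x),y-x\rangle+\frac L2\|y-x\|^2$ for all $x,y$. Gradient assumption: for every stochastic gradient $g_{i,t}=\nabla f(x_{i,t-1};z_{i,t})$, $z_{i,t}\sim\mathcal D_i$, one has $\mathbb E[\|g_{i,t}-\nabla F_i(x_{i,t-1})\|^2]\le V_1$ and $\|\mathbb E[g_{i,t}]\|^2\le V_1'$ for all $i\in[n]$, $t\in[T]$; furthermore, gradients from different workers are independent of each other. (The bound $\mathbb E[\|g_{i,t}\|^2]\le V_2:=V_1+V_1'$ is noted as a consequence.) Global minimum assumption: there exists at least one $x_*$ with $F(x_* )\le F(x)$ for all $x$.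
   Formalization: L-smoothness is taken two-sided, |F_i(y)−F_i(x)−⟨∇F_i(x),y−x⟩| ≤ (L/2)‖y−x‖², as the upper bound alone makes the claim false; the bound on E[g_{i,t}] is read given x_{i,t−1}, almost surely, and E_z∇f(x;z)=∇F_i(x) is made explicit. *)

theory Defs
  imports "HOL-Probability.Probability"
begin

definition gradient :: "('a::euclidean_space \<Rightarrow> real) \<Rightarrow> 'a \<Rightarrow> 'a" where
  "gradient f x = (THE D. GDERIV f x :> D)"

(* The bound is two-sided, i.e. the usual quadratic upper bound is required of both f and -f.
   This is equivalent to the gradient being L-Lipschitz; the upper bound alone is not, as it puts
   no limit on how concave f may be. *)
definition L_smooth :: "real \<Rightarrow> ('a::euclidean_space \<Rightarrow> real) \<Rightarrow> bool" where
  "L_smooth L f \<longleftrightarrow>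
     (\<forall>x. f differentiable (at x)) \<and>
     (\<forall>x y. \<bar>f y - f x - gradient f x \<bullet> (y - x)\<bar> \<le> L / 2 * (norm (y - x))\<^sup>2)"

definition approx_compressor :: "real \<Rightarrow> ('a::euclidean_space \<Rightarrow> 'a) \<Rightarrow> bool" where
  "approx_compressor \<delta> C \<longleftrightarrow>
     \<delta> \<in> {0..1} \<and> (\<forall>v. (norm (C v - v))\<^sup>2 \<le> (1 - \<delta>) * (norm v)\<^sup>2)"

text \<open>Workers are the indices \<open>1, \<dots>, n\<close>; worker-indexed families are functions on \<open>nat\<close> whose values
  outside this range are never used.\<close>

definition avg :: "nat \<Rightarrow> (nat \<Rightarrow> 'a::real_vector) \<Rightarrow> 'a" where
  "avg n v = (1 / real n) *\<^sub>R (\<Sum>i=1..n. v i)"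

definition local_obj :: "('a::euclidean_space \<Rightarrow> 'z \<Rightarrow> real) \<Rightarrow> (nat \<Rightarrow> 'z measure) \<Rightarrow> nat \<Rightarrow> 'a \<Rightarrow> real" where
  "local_obj f D i x = (\<integral>s. f x s \<partial>D i)"

definition global_obj :: "('a::euclidean_space \<Rightarrow> 'z \<Rightarrow> real) \<Rightarrow> (nat \<Rightarrow> 'z measure) \<Rightarrow> nat \<Rightarrow> 'a \<Rightarrow> real" where
  "global_obj f D n x = avg n (\<lambda>i. local_obj f D i x)"

definition sgrad :: "('a::euclidean_space \<Rightarrow> 'z \<Rightarrow> real) \<Rightarrow> 'a \<Rightarrow> 'z \<Rightarrow> 'a" where
  "sgrad f x s = gradient (\<lambda>y. f y s) x"

definition psync :: "nat \<Rightarrow> (nat \<Rightarrow> 'a::euclidean_space) \<Rightarrow> ('a \<Rightarrow> 'a) \<Rightarrow> nat \<Rightarrow> 'a \<times> 'a" where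
  "psync n v C i = (let r = v i - C (v i) in (avg n (\<lambda>k. C (v k)) + r, r))"

text \<open>The state of M-CSER after \<open>t\<close> iterations, as the triple of families \<open>(x\<^sub>i, e\<^sub>i, m\<^sub>i)\<close>, along one
  realisation of the samples: \<open>\<zeta> i t\<close> is the sample drawn by worker \<open>i\<close> in iteration \<open>t\<close>.\<close>

primrec mcser ::
  "('a::euclidean_space \<Rightarrow> 'z \<Rightarrow> real) \<Rightarrow> nat \<Rightarrow> ('a \<Rightarrow> 'a) \<Rightarrow> ('a \<Rightarrow> 'a) \<Rightarrow> nat \<Rightarrow> real \<Rightarrow> real \<Rightarrow> 'a \<Rightarrow>
   (nat \<Rightarrow> nat \<Rightarrow> 'z) \<Rightarrow> nat \<Rightarrow> (nat \<Rightarrow> 'a) \<times> (nat \<Rightarrow> 'a) \<times> (nat \<Rightarrow> 'a)" where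
  "mcser f n C1 C2 H \<beta> \<eta> x0 \<zeta> 0 = ((\<lambda>i. x0), (\<lambda>i. 0), (\<lambda>i. 0))"
| "mcser f n C1 C2 H \<beta> \<eta> x0 \<zeta> (Suc t) =
    (let (x, e, m) = mcser f n C1 C2 H \<beta> \<eta> x0 \<zeta> t;
         g = (\<lambda>i. sgrad f (x i) (\<zeta> i (Suc t)));
         m' = (\<lambda>i. \<beta> *\<^sub>R m i + g i);
         p = (\<lambda>i. \<eta> *\<^sub>R (\<beta> *\<^sub>R m' i + g i));
         xh = (\<lambda>i. x i - fst (psync n p C2 i));
         eh = (\<lambda>i. e i - snd (psync n p C2 i))
     in if H dvd Suc t
        then ((\<lambda>i. xh i - eh i + fst (psync n eh C1 i)), (\<lambda>i. snd (psync n eh C1 i)), m')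
        else (xh, eh, m'))"

definition mcser_x ::
  "('a::euclidean_space \<Rightarrow> 'z \<Rightarrow> real) \<Rightarrow> nat \<Rightarrow> ('a \<Rightarrow> 'a) \<Rightarrow> ('a \<Rightarrow> 'a) \<Rightarrow> nat \<Rightarrow> real \<Rightarrow> real \<Rightarrow> 'a \<Rightarrow>
   (nat \<Rightarrow> nat \<Rightarrow> 'z) \<Rightarrow> nat \<Rightarrow> nat \<Rightarrow> 'a" where
  "mcser_x f n C1 C2 H \<beta> \<eta> x0 \<zeta> i t = fst (mcser f n C1 C2 H \<beta> \<eta> x0 \<zeta> t) i"

end

theory Submission
  imports Defs
begin

text \<open>
  The averaged iterates follow Nesterov's momentum method with gradient \<open>g = G + \<xi>\<close>, where \<open>G\<close> is the mean of
  the local gradients at the local iterates and \<open>\<xi>\<close> is the mean noise. With \<open>\<gamma> = \<eta> / (1 - \<beta>)\<close> and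
  \<open>\<theta> = L \<gamma> \<le> 1 / 2\<close>, the usual auxiliary point \<open>x - \<gamma> \<beta>\<^sup>2 m\<close> moves by \<open>- \<gamma> g\<close>, but the descent inequality
  at that point alone loses a constant factor in the term with \<open>\<beta>\<^sup>4\<close>. The potential used here is
  \<open>F (x - (1 - \<theta>) \<gamma> \<beta>\<^sup>2 m) + \<gamma> C (1 - \<beta>)\<^sup>2 |m|\<^sup>2 / 2\<close>: shortening the look-ahead by the factor \<open>1 - \<theta>\<close> and
  adding the momentum energy with a suitable weight \<open>C\<close> makes the quadratic form in \<open>m\<close> and \<open>G\<close> that is left
  over nonnegative. The price is a factor \<open>3 / 2\<close> on the squared bias \<open>|G - \<nabla>F|\<^sup>2\<close>; it is recovered because
  the error of a worker grows only linearly between two synchronizations, so that its mean square over a period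
  is smaller than its final value.
\<close>

section \<open>The weight of the momentum energy\<close>

text \<open>The final bound dictates what the potential may cost. Its term with
  \<open>\<beta> ^ 4\<close> is \<open>\<kappa>\<^sup>2 * V2\<close>: the \<open>V1'\<close> part
  pays for \<open>\<kappa>\<^sup>2 |G|\<^sup>2\<close>, the \<open>V1\<close> part for any weight
  beyond \<open>\<theta>\<close> on the squared mean noise; hence the upper bound on
  \<open>C\<close>. Shortening the look-ahead helps twice: it scales down the distance between the
  gradients at the look-ahead point and at \<open>x\<close> by \<open>1 - \<theta>\<close>, and it
  lowers the noise weight from \<open>\<theta>\<close> to \<open>\<theta> * A\<^sup>2\<close>, which
  leaves room for \<open>C\<close>. Compression never touches the averaged recursion, because the
  residuals that PSync keeps locally and the corrections that it hands out cancel in the mean. It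
  acts only through the bias, and there through the errors \<open>e\<close>, since
  \<open>x - e\<close> is the same for all workers. The noise is shown to be orthogonal to
  everything built from the other samples by Fubini on the joint law of one sample and the rest, so
  that no conditional expectations occur.\<close>

text \<open>For large \<open>\<kappa>\<close> the weight \<open>C\<close> is the one that cancels the mixed term of the form in \<open>m\<close> and \<open>d\<close>. For small
  \<open>\<kappa>\<close> that choice violates the upper bound on \<open>C\<close>; there the form is rewritten in \<open>m\<close> and \<open>P = m + A d\<close> with
  \<open>s = (1 - \<beta>) / A\<close>. The threshold \<open>47 / 100\<close> has to lie below \<open>\<surd>2 / 3\<close> for the second case and to satisfy
  \<open>1 - \<kappa> \<le> 12 \<kappa>\<^sup>2 / 5\<close> for the first.\<close>

lemma ex_momentum_weight:
  fixes \<beta> \<theta> :: real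
  assumes \<beta>: "0 \<le> \<beta>" "\<beta> < 1" and \<theta>: "0 < \<theta>" "\<theta> \<le> 1 / 2"
  defines "\<kappa> \<equiv> \<theta> * \<beta>\<^sup>2 / (1 - \<beta>)" and "A \<equiv> 1 - \<theta> * \<beta>\<^sup>2"
  obtains C where "0 \<le> C" "C * (1 - \<beta>)\<^sup>2 + \<theta> * A\<^sup>2 \<le> \<theta> + \<kappa>\<^sup>2"
    "\<And>m d :: 'a::real_inner. 0 \<le> (1 - \<theta>) * (norm (m + A *\<^sub>R d))\<^sup>2 - 3 * (\<theta> * \<beta>\<^sup>2)\<^sup>2 * (norm d)\<^sup>2
       - 2 * (1 - \<theta>) * \<kappa> * norm m * norm (m + A *\<^sub>R d)
       - C * (2 * (1 - \<beta>) * (m \<bullet> d) + (1 - \<beta>)\<^sup>2 * (norm d)\<^sup>2) + \<kappa>\<^sup>2 * (norm (m + d))\<^sup>2"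
proof -
  define r where "r = 1 - \<beta>"
  have r: "0 < r" "r \<le> 1" using \<beta> by (auto simp: r_def)
  have \<beta>1: "\<beta>\<^sup>2 \<le> 1" using \<beta> by (simp add: power_le_one)
  have B: "0 \<le> \<theta> * \<beta>\<^sup>2" "\<theta> * \<beta>\<^sup>2 \<le> 1 / 2"
    using \<theta> \<beta>1 mult_mono[of \<theta> "1/2" "\<beta>\<^sup>2" 1] by auto
  have A: "1 / 2 \<le> A" "A \<le> 1" using B by (auto simp: A_def)
  have \<kappa>: "0 \<le> \<kappa>" "\<theta> * \<beta>\<^sup>2 = \<kappa> * r" using r B by (auto simp: \<kappa>_def r_def[symmetric])
  \<comment> \<open>Turns the second claim into an upper bound on
    \<open>C * (1 - \<beta>)\<^sup>2\<close> alone; each case proves it as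
    \<open>noise\<close>.\<close>
  have sumA: "\<theta> * A\<^sup>2 = \<theta> - \<theta> * (\<theta> * \<beta>\<^sup>2) * (1 + A)"
    by (simp add: A_def power2_eq_square algebra_simps)
  show thesis
  proof (cases "\<kappa> \<le> 47 / 100")
    case False
    then have k: "47 / 100 < \<kappa>" by simp
    \<comment> \<open>After \<open>2 |m| |P| \<le> |m|\<^sup>2 + |P|\<^sup>2\<close> with
      \<open>P = m + A d\<close>, \<open>W\<close> is the coefficient of \<open>|P|\<^sup>2\<close>
      and the mixed term has coefficient \<open>2 * (A * W - C * r + \<kappa>\<^sup>2)\<close>. With
      this \<open>C\<close> it vanishes, and only the signs of \<open>mm\<close> and
      \<open>dd\<close> remain to be checked.\<close>
    define W where "W = (1 - \<theta>) * (1 - \<kappa>)"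
    define C where "C = (A * W + \<kappa>\<^sup>2) / r"
    have Cr: "C * r = A * W + \<kappa>\<^sup>2" using r by (simp add: C_def)
    have W1: "W \<ge> 1 - \<kappa>" if "\<kappa> > 1"
    proof -
      have "\<theta> * (\<kappa> - 1) \<ge> 0" using that \<theta> by simp
      then show ?thesis by (simp add: W_def algebra_simps)
    qed
    have Wpos: "W \<ge> 0" if "\<kappa> \<le> 1" using that \<theta> by (simp add: W_def)
    have AW: "A * W \<ge> - \<kappa>\<^sup>2 / 4"
    proof (cases "\<kappa> \<le> 1")
      case True
      then have "A * W \<ge> 0" using Wpos A by simp
      then show ?thesis using zero_le_power2[of \<kappa>] by linarith
    next
      case f: False
      have "A * W \<ge> A * (1 - \<kappa>)" using W1 f A by (intro mult_left_mono) auto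
      moreover have "A * (\<kappa> - 1) \<le> 1 * (\<kappa> - 1)" using f A by (intro mult_right_mono) auto
      moreover have "(\<kappa> - 2)\<^sup>2 \<ge> 0" by simp
      ultimately show ?thesis by (simp add: power2_eq_square algebra_simps)
    qed
    have C0: "C \<ge> 0"
    proof -
      have "A * W + \<kappa>\<^sup>2 \<ge> 0" using AW zero_le_power2[of \<kappa>] by linarith
      then show ?thesis using r by (simp add: C_def)
    qed
    \<comment> \<open>A large \<open>\<kappa>\<close> forces \<open>\<beta>\<close> towards 1: for
      \<open>r > 2 / 5\<close> the product \<open>\<kappa> * r\<close> would be at least 0.188,
      while \<open>\<theta> * \<beta>\<^sup>2\<close> is at most 0.18.\<close>
    have rbound: "r \<le> 2 / 5"
    proof (rule ccontr)
      assume "\<not> r \<le> 2 / 5"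
      then have "\<beta> \<le> 3/5" by (simp add: r_def)
      then have "\<beta>\<^sup>2 \<le> (3/5)\<^sup>2" using \<beta> by (intro power_mono) auto
      then have "\<theta> * \<beta>\<^sup>2 \<le> 1/2 * (9/25)" using \<theta> by (intro mult_mono) (auto simp: power2_eq_square)
      moreover have "\<kappa> * r \<ge> 47/100 * (2/5)" using k \<open>\<not> r \<le> 2/5\<close> by (intro mult_mono) auto
      ultimately show False using \<kappa> by simp
    qed
    have noise: "C * r\<^sup>2 \<le> \<kappa>\<^sup>2 + \<theta> * (\<theta> * \<beta>\<^sup>2) * (1 + A)"
    proof -
      have "r * (A * W) \<le> \<kappa>\<^sup>2 * \<beta> + \<theta> * (\<theta> * \<beta>\<^sup>2) * (1 + A)"
      proof (cases "\<kappa> \<le> 1")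
        case True
        have "A * W \<le> 1 * (1 - \<kappa>)"
        proof (rule mult_mono)
          show "W \<le> 1 - \<kappa>" using True \<theta> by (simp add: W_def mult_left_le_one_le)
        qed (use A True Wpos in auto)
        also have "\<dots> \<le> 12/5 * \<kappa>\<^sup>2"
        proof -
          have "\<kappa> * \<kappa> \<ge> 47/100 * \<kappa>" using k by (intro mult_right_mono) auto
          then have "12/5 * (47/100 * \<kappa>) \<le> 12/5 * (\<kappa> * \<kappa>)" by (intro mult_left_mono) auto
          moreover have "1 * (1 - \<kappa>) \<le> 12/5 * (47/100 * \<kappa>)" using k by simp
          ultimately show ?thesis unfolding power2_eq_square by (rule order_trans[rotated])
        qed
        finally have 1: "r * (A * W) \<le> r * (12/5 * \<kappa>\<^sup>2)" using r by (intro mult_left_mono) auto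
        have b: "\<beta> \<noteq> 0" using \<kappa> k r by auto
        \<comment> \<open>Divided by \<open>\<beta>\<^sup>2\<close> this is the wanted bound,
          because \<open>\<theta> * (\<theta> * \<beta>\<^sup>2) = \<kappa>\<^sup>2 * r\<^sup>2 /
          \<beta>\<^sup>2\<close>; the \<open>3 / 2\<close> is the lower bound of
          \<open>1 + A\<close>.\<close>
        have "12/5 * r * \<beta>\<^sup>2 \<le> \<beta>^3 + 3/2 * r\<^sup>2"
        proof -
          have "\<beta>^3 + 3/2 * r\<^sup>2 - 12/5 * r * \<beta>\<^sup>2 = (1-r)^3 + 3/2 * r\<^sup>2 - 12/5 * r * (1-r)\<^sup>2"
            by (simp add: r_def)
          also have "\<dots> = (1 - 27/10 * r)\<^sup>2 + 201/100 * r\<^sup>2 - 17/5 * r^3"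
            by (simp add: power2_eq_square power3_eq_cube field_simps)
          also have "\<dots> \<ge> 0"
          proof -
            have "r\<^sup>2 * (201/100 - 17/5 * r) \<ge> 0" using rbound by (intro mult_nonneg_nonneg) auto
            then have "201/100 * r\<^sup>2 - 17/5 * r^3 \<ge> 0" 
              by (simp add: power2_eq_square power3_eq_cube algebra_simps)
            then show ?thesis using zero_le_power2[of "1 - 27/10 * r"] by linarith
          qed
          finally show ?thesis by simp
        qed
        then have "12/5 * r \<le> (\<beta>^3 + 3/2 * r\<^sup>2) / \<beta>\<^sup>2" using b by (simp add: pos_le_divide_eq)
        also have "\<dots> = \<beta> + 3/2 * r\<^sup>2 / \<beta>\<^sup>2" using b
          by (simp add: add_divide_distrib power2_eq_square power3_eq_cube)
        finally have "12/5 * r * \<kappa>\<^sup>2 \<le> (\<beta> + 3/2 * r\<^sup>2 / \<beta>\<^sup>2) * \<kappa>\<^sup>2" by (intro mult_right_mono) auto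
        also have "\<dots> = \<kappa>\<^sup>2 * \<beta> + \<theta> * (\<theta> * \<beta>\<^sup>2) * (3/2)"
          using b r unfolding \<kappa>_def r_def[symmetric] by (simp add: field_simps power2_eq_square)
        also have "\<dots> \<le> \<kappa>\<^sup>2 * \<beta> + \<theta> * (\<theta> * \<beta>\<^sup>2) * (1 + A)"
          using A B \<theta> by (intro add_left_mono mult_left_mono) auto
        finally show ?thesis using 1 by simp
      next
        case f: False
        then have "W \<le> 0" using \<theta> by (simp add: W_def mult_nonneg_nonpos)
        then have "r * (A * W) \<le> 0" using r A by (simp add: mult_nonneg_nonpos)
        moreover have "0 \<le> \<kappa>\<^sup>2 * \<beta> + \<theta> * (\<theta> * \<beta>\<^sup>2) * (1 + A)" using B A \<theta> \<beta> by simp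
        ultimately show ?thesis by simp
      qed
      moreover have "C * r\<^sup>2 = r * (A * W) + \<kappa>\<^sup>2 * r"
      proof -
        have "C * r\<^sup>2 = (C * r) * r" by (simp add: power2_eq_square)
        then show ?thesis by (simp add: Cr algebra_simps)
      qed
      moreover have "\<kappa>\<^sup>2 * r = \<kappa>\<^sup>2 - \<kappa>\<^sup>2 * \<beta>" by (simp add: r_def algebra_simps)
      ultimately show ?thesis by simp
    qed
    define mm where "mm = W - (1 - \<theta>) * \<kappa> + \<kappa>\<^sup>2"
    define dd where "dd = A * A * W - 3 * (\<theta> * \<beta>\<^sup>2)\<^sup>2 - C * r\<^sup>2 + \<kappa>\<^sup>2"
    have mm0: "mm \<ge> 0"
    proof (cases "\<kappa> \<le> 1/2")
      case True
      have "\<theta> * (1 - 2 * \<kappa>) \<le> 1/2 * (1 - 2 * \<kappa>)" using True \<theta> by (intro mult_right_mono) auto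
      moreover have "(\<kappa> - 1/2)\<^sup>2 \<ge> 0" by simp
      ultimately show ?thesis by (simp add: mm_def W_def power2_eq_square algebra_simps)
    next
      case f: False
      have "\<theta> * (2 * \<kappa> - 1) \<ge> 0" using f \<theta> by simp
      moreover have "(\<kappa> - 1)\<^sup>2 \<ge> 0" by simp
      ultimately show ?thesis by (simp add: mm_def W_def power2_eq_square algebra_simps)
    qed
    have rA: "0 \<le> A - r" "A - r \<le> 1" using rbound A r by auto
    have dd0: "dd \<ge> 0"
    proof -
      \<comment> \<open>The choice of \<open>C\<close> eliminates \<open>C * r\<close>, and
        \<open>\<theta> * \<beta>\<^sup>2 = \<kappa> * r\<close> produces the
        \<open>3 * r\<^sup>2\<close>.\<close>
      have e: "dd = (A - r) * (A * W) + \<kappa>\<^sup>2 * (1 - r - 3 * r\<^sup>2)"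
      proof -
        have "C * r\<^sup>2 = (C * r) * r" by (simp add: power2_eq_square)
        then show ?thesis unfolding dd_def \<kappa>(2) Cr by (simp add: power2_eq_square algebra_simps)
      qed
      show ?thesis
      proof (cases "\<kappa> \<le> 1")
        case True
        have "r\<^sup>2 \<le> (2/5) * r" using rbound r by (simp add: power2_eq_square mult_right_mono)
        then have "1 - r - 3 * r\<^sup>2 \<ge> 0" using rbound by simp
        then show ?thesis unfolding e using rA A Wpos[OF True] by (intro add_nonneg_nonneg mult_nonneg_nonneg) auto
      next
        case f: False
        \<comment> \<open>For \<open>\<kappa> > 1\<close> the product \<open>A * W\<close> can be as
          low as \<open>- \<kappa>\<^sup>2 / 4\<close>. The sharper bound on \<open>r\<close> makes
          the other summand of \<open>dd\<close> at least \<open>\<kappa>\<^sup>2 / 4\<close>, which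
          compensates.\<close>
        have "r \<le> 3/10"
        proof (rule ccontr)
          assume "\<not> r \<le> 3/10"
          then have "\<beta> \<le> 7/10" by (simp add: r_def)
          then have "\<beta>\<^sup>2 \<le> (7/10)\<^sup>2" using \<beta> by (intro power_mono) auto
          then have "\<theta> * \<beta>\<^sup>2 \<le> 1/2 * (49/100)" using \<theta> by (intro mult_mono) (auto simp: power2_eq_square)
          moreover have "\<kappa> * r \<ge> 1 * (3/10)" using f \<open>\<not> r \<le> 3/10\<close> by (intro mult_mono) auto
          ultimately show False using \<kappa> by simp
        qed
        moreover from this have "r\<^sup>2 \<le> (3/10) * r" using r by (simp add: power2_eq_square mult_right_mono)
        ultimately have "1 - r - 3 * r\<^sup>2 \<ge> 1/4" by simp
        then have "\<kappa>\<^sup>2 * (1 - r - 3 * r\<^sup>2) \<ge> \<kappa>\<^sup>2 * (1/4)" by (intro mult_left_mono) auto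
        moreover have "(A - r) * (A * W) \<ge> - \<kappa>\<^sup>2 / 4"
        proof -
          have "(A - r) * (A * W) \<ge> (A - r) * (- \<kappa>\<^sup>2 / 4)" using AW rA by (intro mult_left_mono) auto
          moreover have "(A - r) * (\<kappa>\<^sup>2 / 4) \<le> 1 * (\<kappa>\<^sup>2 / 4)" using rA by (intro mult_right_mono) auto
          ultimately show ?thesis by simp
        qed
        ultimately show ?thesis unfolding e by simp
      qed
    qed
    show thesis
    proof (rule that[of C])
      show "0 \<le> C" by (fact C0)
      show "C * (1 - \<beta>)\<^sup>2 + \<theta> * A\<^sup>2 \<le> \<theta> + \<kappa>\<^sup>2"
        using noise sumA by (simp add: r_def)
      fix m d :: 'a
      let ?P = "m + A *\<^sub>R d"
      have "2 * norm m * norm ?P \<le> (norm m)\<^sup>2 + (norm ?P)\<^sup>2"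
        by (rule sum_squares_bound)
      then have "(1 - \<theta>) * \<kappa> * (2 * norm m * norm ?P) \<le> (1 - \<theta>) * \<kappa> * ((norm m)\<^sup>2 + (norm ?P)\<^sup>2)"
        using \<theta> \<kappa> by (intro mult_left_mono) auto
      moreover have "(1 - \<theta>) * (norm ?P)\<^sup>2 - 3 * (\<theta> * \<beta>\<^sup>2)\<^sup>2 * (norm d)\<^sup>2
          - (1 - \<theta>) * \<kappa> * ((norm m)\<^sup>2 + (norm ?P)\<^sup>2)
          - C * (2 * (1 - \<beta>) * (m \<bullet> d) + (1 - \<beta>)\<^sup>2 * (norm d)\<^sup>2) + \<kappa>\<^sup>2 * (norm (m + d))\<^sup>2
          = mm * (norm m)\<^sup>2 + dd * (norm d)\<^sup>2 + 2 * (A * W - C * r + \<kappa>\<^sup>2) * (m \<bullet> d)"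
        unfolding power2_norm_eq_inner mm_def dd_def W_def r_def
        by (simp add: inner_add_left inner_add_right inner_commute[of d m] algebra_simps power2_eq_square)
      moreover have "mm * (norm m)\<^sup>2 + dd * (norm d)\<^sup>2 \<ge> 0" using mm0 dd0 by simp
      moreover have "2 * (A * W - C * r + \<kappa>\<^sup>2) * (m \<bullet> d) = 0" by (simp add: Cr)
      moreover have "2 * (1 - \<theta>) * \<kappa> * norm m * norm ?P = (1 - \<theta>) * \<kappa> * (2 * norm m * norm ?P)" by simp
      ultimately show "0 \<le> (1 - \<theta>) * (norm ?P)\<^sup>2 - 3 * (\<theta> * \<beta>\<^sup>2)\<^sup>2 * (norm d)\<^sup>2
       - 2 * (1 - \<theta>) * \<kappa> * norm m * norm ?P
       - C * (2 * (1 - \<beta>) * (m \<bullet> d) + (1 - \<beta>)\<^sup>2 * (norm d)\<^sup>2) + \<kappa>\<^sup>2 * (norm (m + d))\<^sup>2"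
        by linarith
    qed
  next
    case True
    define E where "E = 1 - \<theta> * \<beta>"
    have tb: "\<theta> * \<beta> \<le> 1/2 * \<beta>" using \<theta> \<beta> by (intro mult_right_mono) auto
    have E: "1/2 \<le> E" "1 - \<beta>/2 \<le> E" using tb \<beta> by (auto simp: E_def)
    define s where "s = r / A"
    \<comment> \<open>With \<open>C * s = c\<close> the \<open>C\<close>-term of the form becomes
      \<open>c (|P|\<^sup>2 - |m|\<^sup>2) - c (1 - s) |A d|\<^sup>2\<close>. The mixed product is
      split by Young's inequality into \<open>|P|\<^sup>2 / 3\<close> and
      \<open>3 \<kappa>\<^sup>2 |m|\<^sup>2\<close>; \<open>c1\<close> covers the latter and
      \<open>c2\<close> covers \<open>3 (\<theta> \<beta>\<^sup>2)\<^sup>2 |d|\<^sup>2\<close>. What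
      limits \<open>c\<close> is the remaining share \<open>2 / 3 * (1 - \<theta>)\<close> of
      \<open>|P|\<^sup>2\<close>.\<close>
    define c1 where "c1 = 3 * (1 - \<theta>) * \<kappa>\<^sup>2"
    define c2 where "c2 = 3 * \<theta>\<^sup>2 * \<beta>^3 / (A * E)"
    define c where "c = max c1 c2"
    define C where "C = c * A / r"
    have AE: "A - r = \<beta> * E" by (simp add: A_def E_def r_def power2_eq_square algebra_simps)
    have s: "0 \<le> s" "s * A = r" "1 - s = \<beta> * E / A" 
      using A r AE by (auto simp: s_def field_simps)
    have s1: "1 - s \<ge> 0" unfolding s(3) using \<beta> E A by simp
    have c2s: "c2 * (1 - s) = 3 * (\<kappa> * s)\<^sup>2"
    proof -
      have ks: "\<kappa> * s = \<theta> * \<beta>\<^sup>2 / A" using \<kappa>(2) by (simp add: s_def)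
      show ?thesis unfolding ks s(3) c2_def using A E
        by (simp add: power2_eq_square power3_eq_cube)
    qed
    have c0: "0 \<le> c1" "c1 \<le> c" "c2 \<le> c" using \<theta> by (auto simp: c_def c1_def)
    have C0: "0 \<le> C" using c0 A r by (auto simp: C_def)
    have cub: "c \<le> 2/3 * (1 - \<theta>)"
    proof -
      have "\<kappa>\<^sup>2 \<le> (47/100)\<^sup>2" using True \<kappa> by (intro power_mono) auto
      then have "3 * \<kappa>\<^sup>2 \<le> 2/3" by (simp add: power2_eq_square)
      then have "(1 - \<theta>) * (3 * \<kappa>\<^sup>2) \<le> (1 - \<theta>) * (2/3)" using \<theta> by (intro mult_left_mono) auto
      then have "c1 \<le> 2/3 * (1 - \<theta>)" by (simp add: c1_def algebra_simps)
      moreover have "c2 \<le> 2/3 * (1 - \<theta>)"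
      proof -
        have "\<kappa> * r \<le> 47/100 * r" using True r by (intro mult_right_mono) auto
        then have 1: "\<theta> * \<beta>\<^sup>2 \<le> 47/100 * (1 - \<beta>)" unfolding \<kappa>(2) r_def .
        have "3 * \<theta>\<^sup>2 * \<beta>^3 = 3 * (\<theta> * \<beta>) * (\<theta> * \<beta>\<^sup>2)" by (simp add: power2_eq_square power3_eq_cube)
        also have "\<dots> \<le> 3 * (1/2 * \<beta>) * (47/100 * (1 - \<beta>))"
          by (rule mult_mono) (use 1 tb B \<theta> \<beta> in \<open>auto simp: mult.commute\<close>)
        also have "\<dots> \<le> 1/3 * ((53/100 + 47/100 * \<beta>) * (1 - \<beta>/2))"
        proof -
          have "1/3 * ((53/100 + 47/100 * \<beta>) * (1 - \<beta>/2)) - 3 * (1/2 * \<beta>) * (47/100 * (1 - \<beta>))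
              = 1/6 * (1 - 19/10 * \<beta>)\<^sup>2 + (1 - 1/3 * \<beta>) / 100 + 1/40 * \<beta>\<^sup>2"
            by (simp add: power2_eq_square field_simps)
          also have "\<dots> \<ge> 0" using \<beta> by (intro add_nonneg_nonneg) auto
          finally show ?thesis by simp
        qed
        also have "\<dots> \<le> 1/3 * (A * E)"
        proof -
          have "53/100 + 47/100 * \<beta> \<le> A" using 1 by (simp add: A_def)
          then show ?thesis using E \<beta> A by (intro mult_left_mono mult_mono) auto
        qed
        also have "\<dots> \<le> (2/3 * (1 - \<theta>)) * (A * E)"
          using \<theta> A E by (intro mult_right_mono) auto
        finally show ?thesis unfolding c2_def using A E by (simp add: pos_divide_le_eq)
      qed
      ultimately show ?thesis by (simp add: c_def)
    qed
    have noise: "C * r\<^sup>2 \<le> \<kappa>\<^sup>2 + \<theta> * (\<theta> * \<beta>\<^sup>2) * (1 + A)"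
    proof -
      have 1: "\<kappa>\<^sup>2 + \<theta> * (\<theta> * \<beta>\<^sup>2) * (3/2) \<le> \<kappa>\<^sup>2 + \<theta> * (\<theta> * \<beta>\<^sup>2) * (1 + A)"
        using A B \<theta> by (intro add_left_mono mult_left_mono) auto
      \<comment> \<open>Multiplication by \<open>r\<^sup>2\<close> removes the denominator of
        \<open>\<kappa>\<close>; both candidates for \<open>c\<close> are compared in this
        form.\<close>
      have e: "(\<kappa>\<^sup>2 + \<theta> * (\<theta> * \<beta>\<^sup>2) * (3/2)) * r\<^sup>2 = \<theta>\<^sup>2 * \<beta>\<^sup>2 * (\<beta>\<^sup>2 + 3/2 * r\<^sup>2)"
        using r unfolding \<kappa>_def r_def[symmetric] by (simp add: field_simps power2_eq_square)
      have "c1 * A * r \<le> \<kappa>\<^sup>2 + \<theta> * (\<theta> * \<beta>\<^sup>2) * (3/2)"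
      proof -
        have "c1 * A * r \<le> 3 * \<kappa>\<^sup>2 * r"
        proof -
          have "(1 - \<theta>) * A \<le> 1 * 1" using \<theta> A by (intro mult_mono) auto
          then have "((1 - \<theta>) * A) * (3 * \<kappa>\<^sup>2 * r) \<le> 1 * (3 * \<kappa>\<^sup>2 * r)" using r by (intro mult_right_mono) auto
          moreover have "c1 * A * r = ((1 - \<theta>) * A) * (3 * \<kappa>\<^sup>2 * r)" unfolding c1_def by (simp only: mult_ac)
          ultimately show ?thesis by linarith
        qed
        also have "3 * \<kappa>\<^sup>2 * r * r\<^sup>2 \<le> (\<kappa>\<^sup>2 + \<theta> * (\<theta> * \<beta>\<^sup>2) * (3/2)) * r\<^sup>2"
        proof -
          have "3 * r * \<beta>\<^sup>2 \<le> \<beta>\<^sup>2 + 3/2 * r\<^sup>2"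
          proof -
            have "\<beta>\<^sup>2 + 3/2 * r\<^sup>2 - 3 * r * \<beta>\<^sup>2 = (1-r)\<^sup>2 + 3/2 * r\<^sup>2 - 3 * r * (1-r)\<^sup>2"
              by (simp add: r_def)
            also have "\<dots> = (1 - 5/2 * r)\<^sup>2 + r\<^sup>2 * (9/4) - 3 * r^3"
              by (simp add: power2_eq_square power3_eq_cube algebra_simps)
            also have "\<dots> \<ge> 0"
            proof (cases "r \<le> 3/4")
              case True
              then have "r\<^sup>2 * (9/4 - 3 * r) \<ge> 0" by (intro mult_nonneg_nonneg) auto
              then have "r\<^sup>2 * (9/4) - 3 * r^3 \<ge> 0" by (simp add: power2_eq_square power3_eq_cube algebra_simps)
              then show ?thesis using zero_le_power2[of "1 - 5/2 * r"] by linarith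
            next
              case False
              \<comment> \<open>Here the cubic term can win, but by at most \<open>3 / 4\<close>,
                and the square is at least \<open>49 / 64\<close>.\<close>
              have "(5/2 * r - 1)\<^sup>2 \<ge> (7/8)\<^sup>2" using False by (intro power_mono) auto
              then have "(1 - 5/2 * r)\<^sup>2 \<ge> (7/8)\<^sup>2" by (simp add: power2_commute)
              moreover have "r\<^sup>2 * (3 * r - 9/4) \<le> 1 * (3/4)" using False r 
                by (intro mult_mono) (auto simp: power_le_one)
              moreover have "r\<^sup>2 * (9/4) - 3 * r^3 = - (r\<^sup>2 * (3 * r - 9/4))"
                by (simp add: power2_eq_square power3_eq_cube algebra_simps)
              ultimately show ?thesis by (simp add: power2_eq_square)
            qed
            finally show ?thesis by simp
          qed
          then have "\<theta>\<^sup>2 * \<beta>\<^sup>2 * (3 * r * \<beta>\<^sup>2) \<le> \<theta>\<^sup>2 * \<beta>\<^sup>2 * (\<beta>\<^sup>2 + 3/2 * r\<^sup>2)" by (intro mult_left_mono) auto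
          moreover have "3 * \<kappa>\<^sup>2 * r * r\<^sup>2 = \<theta>\<^sup>2 * \<beta>\<^sup>2 * (3 * r * \<beta>\<^sup>2)"
          proof -
            have "3 * \<kappa>\<^sup>2 * r * r\<^sup>2 = 3 * (\<kappa> * r)\<^sup>2 * r" by (simp add: power_mult_distrib)
            then show ?thesis unfolding \<kappa>(2)[symmetric] by (simp add: power2_eq_square mult_ac)
          qed
          ultimately show ?thesis unfolding e by linarith
        qed
        then have "3 * \<kappa>\<^sup>2 * r \<le> \<kappa>\<^sup>2 + \<theta> * (\<theta> * \<beta>\<^sup>2) * (3/2)" using r by simp
        finally show ?thesis .
      qed
      moreover have "c2 * A * r \<le> \<kappa>\<^sup>2 + \<theta> * (\<theta> * \<beta>\<^sup>2) * (3/2)"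
      proof -
        have "6 * r^3 * (1 - r) \<le> (1 + r) * ((1 - r)\<^sup>2 + 3/2 * r\<^sup>2)"
        proof -
          have "(1 + r) * ((1 - r)\<^sup>2 + 3/2 * r\<^sup>2) - 6 * r^3 * (1 - r)
            = 1/2 + (1 - r)\<^sup>2 / 2 + r^3 * (6 * r - 7/2)"
            by (simp add: power2_eq_square power3_eq_cube field_simps)
          also have "\<dots> \<ge> 0"
          proof (cases "r \<le> 7/12")
            case True
            have "0 \<le> 6 * (r - 7/24)\<^sup>2" by simp
            then have "7/2 * r - 6 * r\<^sup>2 \<le> 49/96" by (simp add: power2_eq_square field_simps)
            then have "r\<^sup>2 * (7/2 * r - 6 * r\<^sup>2) \<le> r\<^sup>2 * (49/96)" by (intro mult_left_mono) auto
            also have "r\<^sup>2 \<le> (7/12)\<^sup>2" using True r by (intro power_mono) auto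
            finally have "r\<^sup>2 * (7/2 * r - 6 * r\<^sup>2) \<le> 1/2" by (simp add: power2_eq_square)
            moreover have "r^3 * (6 * r - 7/2) = - (r\<^sup>2 * (7/2 * r - 6 * r\<^sup>2))"
              by (simp add: power2_eq_square power3_eq_cube algebra_simps)
            ultimately show ?thesis using zero_le_power2[of "1 - r"] by linarith
          next
            case False
            then have "r^3 * (6 * r - 7/2) \<ge> 0" using r by simp
            then show ?thesis using zero_le_power2[of "1 - r"] by linarith
          qed
          finally show ?thesis by simp
        qed
        moreover have "1 - r = \<beta>" "1 + r = 2 * (1 - \<beta>/2)" by (auto simp: r_def)
        ultimately have "2 * (3 * r^3 * \<beta>) \<le> 2 * ((1 - \<beta>/2) * (\<beta>\<^sup>2 + 3/2 * r\<^sup>2))"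
          by (simp only: mult.assoc)
        then have "3 * r^3 * \<beta> \<le> (1 - \<beta>/2) * (\<beta>\<^sup>2 + 3/2 * r\<^sup>2)" by linarith
        also have "\<dots> \<le> E * (\<beta>\<^sup>2 + 3/2 * r\<^sup>2)" using E by (intro mult_right_mono) auto
        finally have "3 * r^3 * \<beta> / E \<le> \<beta>\<^sup>2 + 3/2 * r\<^sup>2" using E by (simp add: pos_divide_le_eq mult.commute)
        then have "\<theta>\<^sup>2 * \<beta>\<^sup>2 * (3 * r^3 * \<beta> / E) \<le> \<theta>\<^sup>2 * \<beta>\<^sup>2 * (\<beta>\<^sup>2 + 3/2 * r\<^sup>2)" by (intro mult_left_mono) auto
        moreover have "c2 * A * r * r\<^sup>2 = \<theta>\<^sup>2 * \<beta>\<^sup>2 * (3 * r^3 * \<beta> / E)"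
          using A E by (simp add: c2_def power2_eq_square power3_eq_cube)
        ultimately have "(c2 * A * r) * r\<^sup>2 \<le> (\<kappa>\<^sup>2 + \<theta> * (\<theta> * \<beta>\<^sup>2) * (3/2)) * r\<^sup>2" unfolding e by simp
        then show ?thesis using r by simp
      qed
      ultimately have "c * A * r \<le> \<kappa>\<^sup>2 + \<theta> * (\<theta> * \<beta>\<^sup>2) * (3/2)" by (simp add: c_def max_def)
      moreover have "C * r\<^sup>2 = c * A * r" using r by (simp add: C_def power2_eq_square)
      ultimately show ?thesis using 1 by simp
    qed
    show thesis
    proof (rule that[of C])
      show "0 \<le> C" by (fact C0)
      show "C * (1 - \<beta>)\<^sup>2 + \<theta> * A\<^sup>2 \<le> \<theta> + \<kappa>\<^sup>2"
        using noise sumA by (simp add: r_def)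
      fix m d :: 'a
      define P where "P = m + A *\<^sub>R d"
      have Cs: "C * s = c" using A r by (simp add: C_def s_def)
      have "0 \<le> (norm P / 3 - \<kappa> * norm m)\<^sup>2 * 3" by simp
      then have "2 * \<kappa> * norm m * norm P \<le> (norm P)\<^sup>2 / 3 + 3 * \<kappa>\<^sup>2 * (norm m)\<^sup>2"
        by (simp add: power2_eq_square algebra_simps)
      then have 1: "(1 - \<theta>) * (2 * \<kappa> * norm m * norm P)
        \<le> (1 - \<theta>) * ((norm P)\<^sup>2 / 3 + 3 * \<kappa>\<^sup>2 * (norm m)\<^sup>2)" using \<theta> by (intro mult_left_mono) auto
      have 2: "(2 * (1 - \<beta>) * (m \<bullet> d) + (1 - \<beta>)\<^sup>2 * (norm d)\<^sup>2)
         = s * ((norm P)\<^sup>2 - (norm m)\<^sup>2) - s * (1 - s) * (norm (A *\<^sub>R d))\<^sup>2"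
      proof -
        have "(2 * (1 - \<beta>) * (m \<bullet> d) + (1 - \<beta>)\<^sup>2 * (norm d)\<^sup>2) = 2 * (s * A) * (m \<bullet> d) + (s * A)\<^sup>2 * (norm d)\<^sup>2"
          unfolding s r_def ..
        then show ?thesis unfolding P_def power2_norm_eq_inner
          by (simp add: inner_add_left inner_add_right inner_commute[of d m] algebra_simps power2_eq_square)
      qed
      have 3: "C * (2 * (1 - \<beta>) * (m \<bullet> d) + (1 - \<beta>)\<^sup>2 * (norm d)\<^sup>2)
         = c * ((norm P)\<^sup>2 - (norm m)\<^sup>2) - c * (1 - s) * (norm (A *\<^sub>R d))\<^sup>2"
        unfolding 2 Cs[symmetric] by (simp add: algebra_simps)
      have "c2 * (1 - s) * (norm (A *\<^sub>R d))\<^sup>2 \<le> c * (1 - s) * (norm (A *\<^sub>R d))\<^sup>2"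
        using c0 s1 by (intro mult_right_mono) auto
      moreover have "c2 * (1 - s) * (norm (A *\<^sub>R d))\<^sup>2 = 3 * (\<theta> * \<beta>\<^sup>2)\<^sup>2 * (norm d)\<^sup>2"
        unfolding c2s \<kappa>(2) s(2)[symmetric] using A by (simp add: power_mult_distrib)
      ultimately have 4: "3 * (\<theta> * \<beta>\<^sup>2)\<^sup>2 * (norm d)\<^sup>2 \<le> c * (1 - s) * (norm (A *\<^sub>R d))\<^sup>2" by simp
      have 5: "c * (norm P)\<^sup>2 \<le> 2/3 * (1 - \<theta>) * (norm P)\<^sup>2" using cub by (intro mult_right_mono) auto
      have 6: "3 * (1 - \<theta>) * \<kappa>\<^sup>2 * (norm m)\<^sup>2 \<le> c * (norm m)\<^sup>2"
        using c0 unfolding c1_def by (intro mult_right_mono) auto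
      have 7: "0 \<le> \<kappa>\<^sup>2 * (norm (m + d))\<^sup>2" by simp
      show "0 \<le> (1 - \<theta>) * (norm (m + A *\<^sub>R d))\<^sup>2 - 3 * (\<theta> * \<beta>\<^sup>2)\<^sup>2 * (norm d)\<^sup>2
       - 2 * (1 - \<theta>) * \<kappa> * norm m * norm (m + A *\<^sub>R d)
       - C * (2 * (1 - \<beta>) * (m \<bullet> d) + (1 - \<beta>)\<^sup>2 * (norm d)\<^sup>2) + \<kappa>\<^sup>2 * (norm (m + d))\<^sup>2"
      proof -
        have "(1 - \<theta>) * ((norm P)\<^sup>2 / 3 + 3 * \<kappa>\<^sup>2 * (norm m)\<^sup>2)
            = 1/3 * ((1 - \<theta>) * (norm P)\<^sup>2) + 3 * (1 - \<theta>) * \<kappa>\<^sup>2 * (norm m)\<^sup>2"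
          by (simp add: field_simps)
        moreover have "2 * (1 - \<theta>) * \<kappa> * norm m * norm P = (1 - \<theta>) * (2 * \<kappa> * norm m * norm P)" by simp
        moreover have "c * ((norm P)\<^sup>2 - (norm m)\<^sup>2) = c * (norm P)\<^sup>2 - c * (norm m)\<^sup>2" by (rule right_diff_distrib)
        moreover have "2/3 * (1 - \<theta>) * (norm P)\<^sup>2 = 2/3 * ((1 - \<theta>) * (norm P)\<^sup>2)" by simp
        ultimately show ?thesis unfolding P_def[symmetric] 3 using 1 4 5 6 7 by linarith
      qed
    qed
  qed
qed

section \<open>Smooth functions and the momentum step\<close>

text \<open>The representing vector is assembled from the values of the derivative on the basis. Its
  uniqueness is what makes the definite description in \<open>gradient\<close> denote it.\<close>

lemma differentiable_imp_GDERIV: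
  fixes f :: "'a::euclidean_space \<Rightarrow> real"
  assumes "f differentiable (at x)"
  shows "GDERIV f x :> gradient f x"
proof -
  obtain f' where f': "(f has_derivative f') (at x)"
    using assms by (auto simp: differentiable_def)
  define D where "D = (\<Sum>b\<in>Basis. f' b *\<^sub>R b)"
  have "f' = (\<lambda>h. h \<bullet> D)"
  proof
    fix h
    interpret f': linear f' using f' by (rule has_derivative_linear)
    have "f' h = f' (\<Sum>b\<in>Basis. (h \<bullet> b) *\<^sub>R b)" by (simp add: euclidean_representation)
    also have "\<dots> = (\<Sum>b\<in>Basis. (h \<bullet> b) * f' b)" by (simp add: f'.sum f'.scaleR)
    finally show "f' h = h \<bullet> D" by (simp add: D_def inner_sum_right mult.commute)
  qed
  then have D: "GDERIV f x :> D"
    using f' by (simp add: gderiv_def)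
  have "D' = D" if "GDERIV f x :> D'" for D'
  proof -
    have "(\<lambda>h. h \<bullet> D') = (\<lambda>h. h \<bullet> D)"
      using that D unfolding gderiv_def by (rule has_derivative_unique)
    then have "(D' - D) \<bullet> D' = (D' - D) \<bullet> D" by metis
    then have "(D' - D) \<bullet> (D' - D) = 0" by (simp add: inner_diff_right)
    then show ?thesis by simp
  qed
  with D show ?thesis unfolding gradient_def by (metis theI)
qed

lemma gradient_eqI: "GDERIV f x :> D \<Longrightarrow> gradient f x = D" for f :: "'a::euclidean_space \<Rightarrow> real"
proof -
  assume D: "GDERIV f x :> D"
  then have "f differentiable (at x)" unfolding gderiv_def by (rule differentiableI)
  then have "GDERIV f x :> gradient f x" by (rule differentiable_imp_GDERIV)
  then have "(\<lambda>h. h \<bullet> gradient f x) = (\<lambda>h. h \<bullet> D)"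
    using D unfolding gderiv_def by (rule has_derivative_unique)
  then have "(gradient f x - D) \<bullet> gradient f x = (gradient f x - D) \<bullet> D" by metis
  then have "(gradient f x - D) \<bullet> (gradient f x - D) = 0" by (simp add: inner_diff_right)
  then show "gradient f x = D" by simp
qed

lemma L_smoothD:
  assumes "L_smooth L f"
  shows "f differentiable (at x)"
    "f y \<le> f x + gradient f x \<bullet> (y - x) + L / 2 * (norm (y - x))\<^sup>2"
    "f y \<ge> f x + gradient f x \<bullet> (y - x) - L / 2 * (norm (y - x))\<^sup>2"
proof -
  show "f differentiable (at x)" using assms by (simp add: L_smooth_def)
  have "\<bar>f y - f x - gradient f x \<bullet> (y - x)\<bar> \<le> L / 2 * (norm (y - x))\<^sup>2"
    using assms by (simp add: L_smooth_def)
  then show "f y \<le> f x + gradient f x \<bullet> (y - x) + L / 2 * (norm (y - x))\<^sup>2"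
    "f y \<ge> f x + gradient f x \<bullet> (y - x) - L / 2 * (norm (y - x))\<^sup>2" by linarith+
qed

text \<open>Both quadratic bounds are compared at the two points \<open>c \<plusminus> e\<close> around the midpoint \<open>c\<close>, where \<open>e\<close> has half
  the length of \<open>y - x\<close> and points along the difference of the gradients; other choices lose a
  constant factor.\<close>

lemma L_smooth_imp_lipschitz_gradient:
  assumes "L_smooth L f" and L: "0 \<le> L"
  shows "norm (gradient f y - gradient f x) \<le> L * norm (y - x)"
proof (cases "gradient f y = gradient f x")
  case True
  then show ?thesis using L by simp
next
  case False
  define h where "h = gradient f y - gradient f x"
  define d where "d = (1/2) *\<^sub>R (y - x)"
  define e where "e = (norm d / norm h) *\<^sub>R h"
  define c where "c = x + d"
  have h: "norm h > 0" using False by (simp add: h_def)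
  have yd: "y = c + d" "x = c - d" by (simp_all add: c_def d_def algebra_simps flip: scaleR_add_left)
  have ne: "norm e = norm d" using h by (simp add: e_def)
  note * = L_smoothD(2,3)[OF assms(1)]
  \<comment> \<open>In the sum of the four bounds every value of \<open>f\<close> cancels. The
    squared distances are those from \<open>c + e\<close> and \<open>c - e\<close> to both end
    points, so the parallelogram law evaluates their sum.\<close>
  have "h \<bullet> (2 *\<^sub>R e) \<le> L / 2 * ((norm (c + e - x))\<^sup>2 + (norm (c - e - x))\<^sup>2 + (norm (c + e - y))\<^sup>2 + (norm (c - e - y))\<^sup>2)"
    using *(1)[of "c + e" x] *(2)[of x "c - e"] *(2)[of y "c + e"] *(1)[of "c - e" y]
    unfolding h_def by (simp add: inner_diff_left inner_diff_right inner_add_right inner_add_left algebra_simps)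
  also have "(norm (c + e - x))\<^sup>2 + (norm (c - e - x))\<^sup>2 + (norm (c + e - y))\<^sup>2 + (norm (c - e - y))\<^sup>2
      = 4 * (norm d)\<^sup>2 + 4 * (norm e)\<^sup>2"
    unfolding yd power2_norm_eq_inner by (simp add: inner_diff_left inner_diff_right inner_add_right inner_add_left inner_commute)
  also have "h \<bullet> (2 *\<^sub>R e) = 2 * norm d * norm h"
    using h by (simp add: e_def power2_norm_eq_inner[symmetric] power2_eq_square)
  finally have "2 * norm d * norm h \<le> 4 * L * (norm d)\<^sup>2" by (simp add: ne)
  then have le: "norm d * norm h \<le> norm d * (2 * L * norm d)" by (simp add: power2_eq_square mult_ac)
  have "norm d \<noteq> 0"
  proof
    assume "norm d = 0"
    then have "x = y" by (simp add: yd)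
    then show False using False by simp
  qed
  with le have "norm h \<le> 2 * L * norm d" by simp
  then show ?thesis by (simp add: h_def d_def)
qed

section \<open>Averages over the workers\<close>

lemma avg_diff: "avg n (\<lambda>i. a i - b i) = avg n a - avg n b"
  by (simp add: avg_def sum_subtractf scaleR_diff_right)

lemma avg_add: "avg n (\<lambda>i. a i + b i) = avg n a + avg n b"
  by (simp add: avg_def sum.distrib scaleR_add_right)

lemma avg_scaleR: "avg n (\<lambda>i. c *\<^sub>R a i) = c *\<^sub>R avg n a"
  by (simp add: avg_def scaleR_sum_right[symmetric] mult.commute)

lemma avg_const: "n \<ge> 1 \<Longrightarrow> avg n (\<lambda>i. a) = a"
  by (simp add: avg_def sum_constant_scaleR)

lemma avg_cong: "(\<And>i. i \<in> {1..n} \<Longrightarrow> a i = b i) \<Longrightarrow> avg n a = avg n b"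
  by (simp add: avg_def)

lemma avg_mono: "(\<And>i. i \<in> {1..n} \<Longrightarrow> a i \<le> b i) \<Longrightarrow> avg n a \<le> avg n b" for a b :: "nat \<Rightarrow> real"
  unfolding avg_def real_scaleR_def by (intro mult_left_mono sum_mono) auto

lemma inner_avg_left: "avg n a \<bullet> b = avg n (\<lambda>i. a i \<bullet> b)"
  by (simp add: avg_def inner_sum_left)

text \<open>The variance identity. It yields Jensen's inequality for the squared norm, and it lets
  the mean error be dropped when the deviation of the workers is estimated.\<close>

lemma avg_norm_minus_avg:
  fixes a :: "nat \<Rightarrow> 'a::real_inner"
  assumes "n \<ge> 1"
  shows "avg n (\<lambda>i. (norm (a i - avg n a))\<^sup>2) = avg n (\<lambda>i. (norm (a i))\<^sup>2) - (norm (avg n a))\<^sup>2"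
proof -
  define c where "c = avg n a"
  have lin: "avg n (\<lambda>i. u i - v i + k) = avg n u - avg n v + k" for u v :: "nat \<Rightarrow> real" and k
    unfolding avg_add avg_diff avg_const[OF assms] ..
  have "avg n (\<lambda>i. (norm (a i - c))\<^sup>2) = avg n (\<lambda>i. (norm (a i))\<^sup>2 - (2 *\<^sub>R a i) \<bullet> c + c \<bullet> c)"
    unfolding power2_norm_eq_inner
    by (intro avg_cong) (simp add: inner_diff_left inner_diff_right inner_commute[of c "a _"])
  also have "\<dots> = avg n (\<lambda>i. (norm (a i))\<^sup>2) - avg n (\<lambda>i. (2 *\<^sub>R a i) \<bullet> c) + c \<bullet> c"
    by (rule lin)
  also have "avg n (\<lambda>i. (2 *\<^sub>R a i) \<bullet> c) = 2 * (c \<bullet> c)"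
    unfolding inner_avg_left[symmetric] avg_scaleR by (simp add: c_def)
  finally show ?thesis by (simp add: c_def power2_norm_eq_inner)
qed

lemma norm_avg_sqr_le:
  fixes a :: "nat \<Rightarrow> 'a::real_inner"
  assumes "n \<ge> 1"
  shows "(norm (avg n a))\<^sup>2 \<le> avg n (\<lambda>i. (norm (a i))\<^sup>2)"
proof -
  have "0 \<le> avg n (\<lambda>i. (norm (a i - avg n a))\<^sup>2)" by (simp add: avg_def sum_nonneg)
  then show ?thesis unfolding avg_norm_minus_avg[OF assms] by simp
qed

lemma GDERIV_avg:
  fixes F :: "nat \<Rightarrow> 'a::euclidean_space \<Rightarrow> real"
  assumes "n \<ge> 1" "\<And>i. i \<in> {1..n} \<Longrightarrow> GDERIV (F i) x :> D i"
  shows "GDERIV (\<lambda>x. avg n (\<lambda>i. F i x)) x :> avg n D"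
  using assms unfolding gderiv_def avg_def inner_scaleR_right inner_sum_right real_scaleR_def
  by (auto intro!: derivative_eq_intros)

lemma L_smooth_avg:
  fixes F :: "nat \<Rightarrow> 'a::euclidean_space \<Rightarrow> real"
  assumes n: "n \<ge> 1" and F: "\<And>i. i \<in> {1..n} \<Longrightarrow> L_smooth L (F i)"
  shows "gradient (\<lambda>x. avg n (\<lambda>i. F i x)) x = avg n (\<lambda>i. gradient (F i) x)"
    and "L_smooth L (\<lambda>x. avg n (\<lambda>i. F i x))"
proof -
  have D: "GDERIV (\<lambda>x. avg n (\<lambda>i. F i x)) x :> avg n (\<lambda>i. gradient (F i) x)" for x
    using n F by (intro GDERIV_avg differentiable_imp_GDERIV L_smoothD(1)) auto
  then show g: "gradient (\<lambda>x. avg n (\<lambda>i. F i x)) x = avg n (\<lambda>i. gradient (F i) x)" for x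
    by (rule gradient_eqI)
  show "L_smooth L (\<lambda>x. avg n (\<lambda>i. F i x))"
    unfolding L_smooth_def
  proof (intro conjI allI)
    fix x y
    show "(\<lambda>x. avg n (\<lambda>i. F i x)) differentiable (at x)"
      using D[of x] unfolding gderiv_def by (rule differentiableI)
    have "avg n (\<lambda>i. F i y) - avg n (\<lambda>i. F i x) - gradient (\<lambda>x. avg n (\<lambda>i. F i x)) x \<bullet> (y - x)
      = avg n (\<lambda>i. F i y - F i x - gradient (F i) x \<bullet> (y - x))"
      by (simp add: g avg_diff inner_avg_left)
    moreover have "avg n (\<lambda>i. F i y - F i x - gradient (F i) x \<bullet> (y - x)) \<le> avg n (\<lambda>i. L / 2 * (norm (y - x))\<^sup>2)"
    proof (intro avg_mono)
      fix i assume "i \<in> {1..n}"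
      from L_smoothD(2)[OF F[OF this], of y x]
      show "F i y - F i x - gradient (F i) x \<bullet> (y - x) \<le> L / 2 * (norm (y - x))\<^sup>2" by linarith
    qed
    moreover have "avg n (\<lambda>i. F i y - F i x - gradient (F i) x \<bullet> (y - x)) \<ge> avg n (\<lambda>i. - (L / 2 * (norm (y - x))\<^sup>2))"
    proof (intro avg_mono)
      fix i assume "i \<in> {1..n}"
      from L_smoothD(3)[OF F[OF this], of x y]
      show "- (L / 2 * (norm (y - x))\<^sup>2) \<le> F i y - F i x - gradient (F i) x \<bullet> (y - x)" by linarith
    qed
    ultimately show "\<bar>avg n (\<lambda>i. F i y) - avg n (\<lambda>i. F i x) - gradient (\<lambda>x. avg n (\<lambda>i. F i x)) x \<bullet> (y - x)\<bar>
      \<le> L / 2 * (norm (y - x))\<^sup>2" using n by (simp add: avg_const)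
  qed
qed

section \<open>One step of the momentum method\<close>

text \<open>Young's inequality with unequal weights. The small factor goes to the bias, where
  \<open>3 / 2\<close> is just what \<open>sum_expectation_bias\<close> can absorb; the factor 3 is
  the one in front of \<open>(\<theta> * \<beta>\<^sup>2)\<^sup>2\<close> in the quadratic
  form.\<close>

lemma norm_diff_sqr_le_weighted:
  "(norm (a - b))\<^sup>2 \<le> 3 / 2 * (norm a)\<^sup>2 + 3 * (norm b)\<^sup>2" for a b :: "'a::real_inner"
proof -
  have "0 \<le> (norm (a + 2 *\<^sub>R b))\<^sup>2" by simp
  then show ?thesis
    unfolding power2_norm_eq_inner by (simp add: inner_diff_left inner_diff_right inner_add_left inner_add_right inner_commute[of b a])
qed

text \<open>The source is \<open>|v|\<^sup>2 = 2 (v \<bullet> P) - |P|\<^sup>2 + |P -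
  v|\<^sup>2\<close>, where \<open>v\<close> is the gradient at \<open>x\<close> and
  \<open>- \<gamma> P\<close> the noise-free move of the look-ahead point. The descent inequality
  controls \<open>w \<bullet> P\<close> with the gradient \<open>w\<close> at the look-ahead point,
  and the Lipschitz bound replaces \<open>w\<close> by \<open>v\<close>. The rescaled momentum
  \<open>M\<close> has the size of a gradient. Terms linear in \<open>\<xi>\<close> are collected
  against a vector free of \<open>\<xi>\<close>, so that they can vanish in expectation.\<close>

lemma momentum_step:
  fixes F :: "'a::euclidean_space \<Rightarrow> real" and x m G \<xi> :: 'a and C L \<gamma> \<beta> :: real
  assumes smooth: "L_smooth L F" and L: "0 < L" and \<gamma>: "0 < \<gamma>" and \<beta>: "\<beta> < 1"
  defines "\<theta> \<equiv> L * \<gamma>" and "\<kappa> \<equiv> L * \<gamma> * \<beta>\<^sup>2 / (1 - \<beta>)" and "A \<equiv> 1 - L * \<gamma> * \<beta>\<^sup>2"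
    and "M \<equiv> (1 - \<beta>) *\<^sub>R m" and "m' \<equiv> \<beta> *\<^sub>R m + (G + \<xi>)"
  defines "x' \<equiv> x - ((1 - \<beta>) * \<gamma>) *\<^sub>R (\<beta> *\<^sub>R m' + (G + \<xi>))"
    and "y \<equiv> \<lambda>x m. x - ((1 - L * \<gamma>) * \<gamma> * \<beta>\<^sup>2) *\<^sub>R m"
  defines "\<Phi> \<equiv> \<lambda>x m. F (y x m) + \<gamma> / 2 * (C * (1 - \<beta>)\<^sup>2 * (norm m)\<^sup>2)"
  assumes \<theta>: "\<theta> \<le> 1"
    and Q: "\<And>m d :: 'a. 0 \<le> (1 - \<theta>) * (norm (m + A *\<^sub>R d))\<^sup>2 - 3 * (\<theta> * \<beta>\<^sup>2)\<^sup>2 * (norm d)\<^sup>2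
       - 2 * (1 - \<theta>) * \<kappa> * norm m * norm (m + A *\<^sub>R d)
       - C * (2 * (1 - \<beta>) * (m \<bullet> d) + (1 - \<beta>)\<^sup>2 * (norm d)\<^sup>2) + \<kappa>\<^sup>2 * (norm (m + d))\<^sup>2"
  shows "(norm (gradient F x))\<^sup>2 \<le> 2 / \<gamma> * (\<Phi> x m - \<Phi> x' m') + 3 / 2 * (norm (G - gradient F x))\<^sup>2
      + \<kappa>\<^sup>2 * (norm G)\<^sup>2 + (C * (1 - \<beta>)\<^sup>2 + \<theta> * A\<^sup>2) * (norm \<xi>)\<^sup>2
      + ((2 * \<theta> * A) *\<^sub>R (M + A *\<^sub>R (G - M)) + (2 * C * (1 - \<beta>)) *\<^sub>R (M + (1 - \<beta>) *\<^sub>R (G - M))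
          - (2 * A) *\<^sub>R gradient F (y x m)) \<bullet> \<xi>"
proof -
  define d where "d = G - M"
  define P where "P = M + A *\<^sub>R d"
  define v where "v = gradient F x"
  define w where "w = gradient F (y x m)"
  have b: "1 - \<beta> > 0" using \<beta> by simp
  \<comment> \<open>Because of the shortened look-ahead the move is not along \<open>G\<close> but
    along the convex combination \<open>P = A G + (1 - A) M\<close>.\<close>
  have yy: "y x' m' - y x m = - (\<gamma> *\<^sub>R (P + A *\<^sub>R \<xi>))"
    unfolding y_def x'_def m'_def P_def d_def M_def A_def
    by (simp add: algebra_simps power2_eq_square)
  have "F (y x' m') - F (y x m) \<le> w \<bullet> (y x' m' - y x m) + L / 2 * (norm (y x' m' - y x m))\<^sup>2"
    using L_smoothD(2)[OF smooth, of "y x' m'" "y x m"] by (simp add: w_def)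
  also have "\<dots> = \<gamma> / 2 * (\<theta> * (norm (P + A *\<^sub>R \<xi>))\<^sup>2 - 2 * (w \<bullet> (P + A *\<^sub>R \<xi>)))"
    using \<gamma> unfolding yy \<theta>_def norm_minus_cancel norm_scaleR by (simp add: power2_eq_square right_diff_distrib mult_ac)
  finally have F: "2 / \<gamma> * (F (y x' m') - F (y x m)) \<le> \<theta> * (norm (P + A *\<^sub>R \<xi>))\<^sup>2 - 2 * (w \<bullet> (P + A *\<^sub>R \<xi>))"
    using \<gamma> by (simp add: field_simps)
  have mm: "(1 - \<beta>)\<^sup>2 * (norm m')\<^sup>2 = (norm (M + (1 - \<beta>) *\<^sub>R (d + \<xi>)))\<^sup>2"
  proof -
    have "M + (1 - \<beta>) *\<^sub>R (d + \<xi>) = (1 - \<beta>) *\<^sub>R m'"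
      by (simp add: d_def M_def m'_def algebra_simps)
    then show ?thesis using b by (simp add: power_mult_distrib)
  qed
  have mM: "(1 - \<beta>)\<^sup>2 * (norm m)\<^sup>2 = (norm M)\<^sup>2" using b by (simp add: M_def power_mult_distrib)
  have \<Phi>: "2 / \<gamma> * (\<Phi> x m - \<Phi> x' m') = C * ((norm M)\<^sup>2 - (norm (M + (1 - \<beta>) *\<^sub>R (d + \<xi>)))\<^sup>2)
     - 2 / \<gamma> * (F (y x' m') - F (y x m))"
    unfolding \<Phi>_def mm[symmetric] mM[symmetric] using \<gamma> by (simp add: field_simps)
  have wv: "norm (w - v) \<le> (1 - \<theta>) * \<kappa> * norm M"
  proof -
    have "norm (w - v) \<le> L * norm (y x m - x)"
      unfolding w_def v_def using smooth L by (intro L_smooth_imp_lipschitz_gradient) auto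
    also have "\<dots> = (1 - \<theta>) * \<kappa> * norm M"
      using \<theta> \<gamma> b unfolding y_def \<kappa>_def M_def \<theta>_def by (simp add: abs_mult)
    finally show ?thesis .
  qed
  have "(v - w) \<bullet> P \<le> norm (v - w) * norm P" by (rule norm_cauchy_schwarz)
  also have "\<dots> \<le> (1 - \<theta>) * \<kappa> * norm M * norm P"
    using wv by (intro mult_right_mono) (auto simp: norm_minus_commute)
  finally have cs: "v \<bullet> P - w \<bullet> P \<le> (1 - \<theta>) * \<kappa> * norm M * norm P" by (simp add: inner_diff_left)
  \<comment> \<open>The two parts are the bias, which stays in the conclusion, and the pull of
    \<open>P\<close> towards the momentum, which the quadratic form has to absorb.\<close>
  have "P - v = (G - v) - (\<theta> * \<beta>\<^sup>2) *\<^sub>R d"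
    by (simp add: P_def d_def A_def \<theta>_def algebra_simps)
  then have "(norm (P - v))\<^sup>2 \<le> 3 / 2 * (norm (G - v))\<^sup>2 + 3 * ((\<theta> * \<beta>\<^sup>2)\<^sup>2 * (norm d)\<^sup>2)"
    using norm_diff_sqr_le_weighted[of "G - v" "(\<theta> * \<beta>\<^sup>2) *\<^sub>R d"] by (simp only: norm_scaleR power_mult_distrib power2_abs)
  then have vP: "(norm v)\<^sup>2 + (norm P)\<^sup>2 - 2 * (v \<bullet> P) \<le> 3 / 2 * (norm (G - v))\<^sup>2 + 3 * (\<theta> * \<beta>\<^sup>2)\<^sup>2 * (norm d)\<^sup>2"
    unfolding power2_norm_eq_inner by (simp add: inner_diff_left inner_diff_right inner_commute[of P v])
  have MdG: "M + d = G" by (simp add: d_def)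
  have e1: "(norm (P + A *\<^sub>R \<xi>))\<^sup>2 = (norm P)\<^sup>2 + A\<^sup>2 * (norm \<xi>)\<^sup>2 + 2 * A * (P \<bullet> \<xi>)"
    unfolding power2_norm_eq_inner
    by (simp add: inner_add_left inner_add_right inner_commute[of \<xi> P] power2_eq_square algebra_simps)
  have e2: "(norm (M + (1 - \<beta>) *\<^sub>R (d + \<xi>)))\<^sup>2 = (norm M)\<^sup>2 + (2 * (1 - \<beta>) * (M \<bullet> d) + (1 - \<beta>)\<^sup>2 * (norm d)\<^sup>2)
     + (1 - \<beta>)\<^sup>2 * (norm \<xi>)\<^sup>2 + 2 * (1 - \<beta>) * ((M + (1 - \<beta>) *\<^sub>R d) \<bullet> \<xi>)"
  proof -
    have "M + (1 - \<beta>) *\<^sub>R (d + \<xi>) = (M + (1 - \<beta>) *\<^sub>R d) + (1 - \<beta>) *\<^sub>R \<xi>" by (simp add: scaleR_add_right)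
    then have "(norm (M + (1 - \<beta>) *\<^sub>R (d + \<xi>)))\<^sup>2 = (norm (M + (1 - \<beta>) *\<^sub>R d))\<^sup>2
        + 2 * ((M + (1 - \<beta>) *\<^sub>R d) \<bullet> ((1 - \<beta>) *\<^sub>R \<xi>)) + (norm ((1 - \<beta>) *\<^sub>R \<xi>))\<^sup>2"
      unfolding power2_norm_eq_inner by (simp add: inner_add_left inner_add_right inner_commute)
    moreover have "(norm (M + (1 - \<beta>) *\<^sub>R d))\<^sup>2 = (norm M)\<^sup>2 + 2 * (M \<bullet> ((1 - \<beta>) *\<^sub>R d)) + (norm ((1 - \<beta>) *\<^sub>R d))\<^sup>2"
      unfolding power2_norm_eq_inner by (simp add: inner_add_left inner_add_right inner_commute)
    moreover have "2 * (a \<bullet> ((1 - \<beta>) *\<^sub>R b)) = 2 * (1 - \<beta>) * (a \<bullet> b)" for a b :: 'a by simp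
    moreover have "(norm ((1 - \<beta>) *\<^sub>R a))\<^sup>2 = (1 - \<beta>)\<^sup>2 * (norm a)\<^sup>2" for a :: 'a by (simp add: power_mult_distrib)
    ultimately show ?thesis by (simp only: add_ac)
  qed
  \<comment> \<open>Since \<open>M + d = G\<close>, the last term of the form is
    \<open>\<kappa>\<^sup>2 |G|\<^sup>2\<close>, the only place where the size of the gradients is
    paid for.\<close>
  note q = Q[of M d, folded P_def, unfolded MdG]
  have e3: "2 / \<gamma> * (\<Phi> x m - \<Phi> x' m') \<ge>
    - C * (2 * (1 - \<beta>) * (M \<bullet> d) + (1 - \<beta>)\<^sup>2 * (norm d)\<^sup>2) - C * (1 - \<beta>)\<^sup>2 * (norm \<xi>)\<^sup>2
    - 2 * C * (1 - \<beta>) * ((M + (1 - \<beta>) *\<^sub>R d) \<bullet> \<xi>)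
    - (\<theta> * (norm P)\<^sup>2 + \<theta> * A\<^sup>2 * (norm \<xi>)\<^sup>2 + 2 * \<theta> * A * (P \<bullet> \<xi>) - 2 * (w \<bullet> P) - 2 * A * (w \<bullet> \<xi>))"
    using F unfolding \<Phi> e1 e2 by (simp add: algebra_simps)
  have e4: "((2 * \<theta> * A) *\<^sub>R P + (2 * C * (1 - \<beta>)) *\<^sub>R (M + (1 - \<beta>) *\<^sub>R d) - (2 * A) *\<^sub>R w) \<bullet> \<xi>
     = 2 * \<theta> * A * (P \<bullet> \<xi>) + 2 * C * (1 - \<beta>) * ((M + (1 - \<beta>) *\<^sub>R d) \<bullet> \<xi>) - 2 * A * (w \<bullet> \<xi>)"
    by (simp add: inner_diff_left inner_add_left)
  show ?thesis
    unfolding v_def[symmetric] w_def[symmetric] d_def[symmetric] P_def[symmetric] e4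
    using q e3 vP cs by (simp add: algebra_simps)
qed

section \<open>Square-integrable random vectors\<close>

definition sq_integrable :: "'w measure \<Rightarrow> ('w \<Rightarrow> 'a::euclidean_space) \<Rightarrow> bool" where
  "sq_integrable M X \<longleftrightarrow> X \<in> borel_measurable M \<and> integrable M (\<lambda>\<omega>. (norm (X \<omega>))\<^sup>2)"

lemma sq_integrableD:
  assumes "sq_integrable M X"
  shows "X \<in> borel_measurable M" "integrable M (\<lambda>\<omega>. (norm (X \<omega>))\<^sup>2)"
  using assms by (auto simp: sq_integrable_def)

lemma sq_integrable_dominated:
  assumes "sq_integrable M X" "Y \<in> borel_measurable M"
    and "\<And>\<omega>. \<omega> \<in> space M \<Longrightarrow> norm (Y \<omega>) \<le> c * norm (X \<omega>)"
  shows "sq_integrable M Y"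
  unfolding sq_integrable_def
proof
  show "integrable M (\<lambda>\<omega>. (norm (Y \<omega>))\<^sup>2)"
  proof (rule Bochner_Integration.integrable_bound)
    show "integrable M (\<lambda>\<omega>. c\<^sup>2 * (norm (X \<omega>))\<^sup>2)" using sq_integrableD(2)[OF assms(1)] by simp
    show "(\<lambda>\<omega>. (norm (Y \<omega>))\<^sup>2) \<in> borel_measurable M" using assms(2) by measurable
    show "AE \<omega> in M. norm ((norm (Y \<omega>))\<^sup>2) \<le> norm (c\<^sup>2 * (norm (X \<omega>))\<^sup>2)"
    proof (rule AE_I2)
      fix \<omega> assume "\<omega> \<in> space M"
      then have "(norm (Y \<omega>))\<^sup>2 \<le> (c * norm (X \<omega>))\<^sup>2" using assms(3) by (intro power_mono) auto
      then show "norm ((norm (Y \<omega>))\<^sup>2) \<le> norm (c\<^sup>2 * (norm (X \<omega>))\<^sup>2)" by (simp add: power_mult_distrib)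
    qed
  qed
qed (fact assms(2))

lemma sq_integrable_scaleR:
  "sq_integrable M X \<Longrightarrow> sq_integrable M (\<lambda>\<omega>. c *\<^sub>R X \<omega>)"
  by (rule sq_integrable_dominated[where c = "\<bar>c\<bar>"]) (auto dest: sq_integrableD(1))

lemma sq_integrable_add:
  assumes X: "sq_integrable M X" and Y: "sq_integrable M Y"
  shows "sq_integrable M (\<lambda>\<omega>. X \<omega> + Y \<omega>)"
proof -
  note [measurable] = X[THEN sq_integrableD(1)] Y[THEN sq_integrableD(1)]
  show ?thesis unfolding sq_integrable_def
  proof
    show "integrable M (\<lambda>\<omega>. (norm (X \<omega> + Y \<omega>))\<^sup>2)"
    proof (rule Bochner_Integration.integrable_bound)
      show "integrable M (\<lambda>\<omega>. 2 * (norm (X \<omega>))\<^sup>2 + 2 * (norm (Y \<omega>))\<^sup>2)"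
        using sq_integrableD(2)[OF X] sq_integrableD(2)[OF Y] by simp
      show "AE \<omega> in M. norm ((norm (X \<omega> + Y \<omega>))\<^sup>2) \<le> norm (2 * (norm (X \<omega>))\<^sup>2 + 2 * (norm (Y \<omega>))\<^sup>2)"
      proof (rule AE_I2)
        fix \<omega>
        have "0 \<le> (norm (X \<omega> - Y \<omega>))\<^sup>2" by simp
        then have "(norm (X \<omega> + Y \<omega>))\<^sup>2 \<le> 2 * (norm (X \<omega>))\<^sup>2 + 2 * (norm (Y \<omega>))\<^sup>2"
          unfolding power2_norm_eq_inner
          by (simp add: inner_add_left inner_add_right inner_diff_left inner_diff_right inner_commute)
        then show "norm ((norm (X \<omega> + Y \<omega>))\<^sup>2) \<le> norm (2 * (norm (X \<omega>))\<^sup>2 + 2 * (norm (Y \<omega>))\<^sup>2)"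
          by simp
      qed
    qed measurable
  qed measurable
qed

lemma sq_integrable_diff:
  "sq_integrable M X \<Longrightarrow> sq_integrable M Y \<Longrightarrow> sq_integrable M (\<lambda>\<omega>. X \<omega> - Y \<omega>)"
  using sq_integrable_add[OF _ sq_integrable_scaleR[of M Y "- 1"], of X] by simp

lemma (in finite_measure) sq_integrable_const: "sq_integrable M (\<lambda>\<omega>. a)"
  by (simp add: sq_integrable_def)

lemma (in finite_measure) sq_integrable_avg:
  "(\<And>i. i \<in> {1..n} \<Longrightarrow> sq_integrable M (X i)) \<Longrightarrow> sq_integrable M (\<lambda>\<omega>. avg n (\<lambda>i. X i \<omega>))"
proof -
  assume X: "\<And>i. i \<in> {1..n} \<Longrightarrow> sq_integrable M (X i)"
  have "sq_integrable M (\<lambda>\<omega>. \<Sum>i\<in>I. X i \<omega>)" if "finite I" "I \<subseteq> {1..n}" for I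
    using that by (induction I rule: finite_induct) (auto intro!: sq_integrable_add sq_integrable_const X)
  then show ?thesis unfolding avg_def by (intro sq_integrable_scaleR) auto
qed

lemma borel_measurable_lipschitz:
  fixes h :: "'a::real_normed_vector \<Rightarrow> 'b::real_normed_vector"
  assumes lip: "\<And>x y. norm (h y - h x) \<le> c * norm (y - x)"
  shows "h \<in> borel_measurable borel"
proof -
  have "continuous_on UNIV h"
  proof (rule continuous_onI)
    fix x :: 'a and e :: real assume e: "e > 0"
    have "dist (h x') (h x) \<le> e" if "dist x' x < e / (\<bar>c\<bar> + 1)" for x'
    proof -
      have "dist (h x') (h x) \<le> c * dist x' x" using lip[of x' x] by (simp add: dist_norm)
      also have "\<dots> \<le> (\<bar>c\<bar> + 1) * dist x' x" by (intro mult_right_mono) auto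
      also have "\<dots> \<le> (\<bar>c\<bar> + 1) * (e / (\<bar>c\<bar> + 1))" using that by (intro mult_left_mono) auto
      also have "\<dots> = e" by simp
      finally show ?thesis .
    qed
    then show "\<exists>d>0. \<forall>x'\<in>UNIV. dist x' x < d \<longrightarrow> dist (h x') (h x) \<le> e"
      using e by (intro exI[of _ "e / (\<bar>c\<bar> + 1)"]) auto
  qed
  then show ?thesis by (rule borel_measurable_continuous_onI)
qed

lemma (in finite_measure) sq_integrable_lipschitz:
  assumes X: "sq_integrable M X" and lip: "\<And>x y. norm (h y - h x) \<le> c * norm (y - x)"
  shows "sq_integrable M (\<lambda>\<omega>. h (X \<omega>))"
proof -
  note [measurable] = borel_measurable_lipschitz[OF lip]
  note [measurable] = X[THEN sq_integrableD(1)]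
  have "sq_integrable M (\<lambda>\<omega>. h (X \<omega>) - h 0)"
    by (rule sq_integrable_dominated[OF X, where c = c]) (use lip[of _ 0] in auto)
  from sq_integrable_add[OF this sq_integrable_const[of "h 0"]] show ?thesis by simp
qed

lemma sq_integrable_inner:
  assumes X: "sq_integrable M X" and Y: "sq_integrable M Y"
  shows "integrable M (\<lambda>\<omega>. X \<omega> \<bullet> Y \<omega>)"
proof -
  have "(\<lambda>\<omega>. X \<omega> \<bullet> Y \<omega>) = (\<lambda>\<omega>. 1/4 * ((norm (X \<omega> + Y \<omega>))\<^sup>2 - (norm (X \<omega> - Y \<omega>))\<^sup>2))"
    unfolding power2_norm_eq_inner
    by (auto simp: inner_add_left inner_add_right inner_diff_left inner_diff_right inner_commute)
  then show ?thesis
    using sq_integrableD(2)[OF sq_integrable_add[OF X Y]] sq_integrableD(2)[OF sq_integrable_diff[OF X Y]] by simp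
qed

section \<open>Bounds on the norm in L2\<close>

text \<open>States that \<open>a\<close> bounds the L2 norm of \<open>X\<close>. Keeping
  \<open>a\<close> unsquared makes bounds add under sums, so the recursions for momentum and error
  become scalar ones.\<close>

definition l2_le :: "'w measure \<Rightarrow> ('w \<Rightarrow> 'a::euclidean_space) \<Rightarrow> real \<Rightarrow> bool" where
  "l2_le M X a \<longleftrightarrow> sq_integrable M X \<and> 0 \<le> a \<and> (\<integral>\<omega>. (norm (X \<omega>))\<^sup>2 \<partial>M) \<le> a\<^sup>2"

lemma l2_le_zero: "l2_le M (\<lambda>\<omega>. 0) 0"
  by (simp add: l2_le_def sq_integrable_def)

lemma l2_le_mono: "l2_le M X a \<Longrightarrow> a \<le> b \<Longrightarrow> l2_le M X b"
  unfolding l2_le_def by (auto intro: order_trans power_mono)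

text \<open>Minkowski's inequality in terms of the bounds. The cross term is split by Young's
  inequality with the ratio of the two bounds as weight, which makes the right-hand side a perfect
  square.\<close>

lemma l2_le_add:
  assumes X: "l2_le M X a" and Y: "l2_le M Y b"
  shows "l2_le M (\<lambda>\<omega>. X \<omega> + Y \<omega>) (a + b)"
proof -
  have si: "sq_integrable M X" "sq_integrable M Y" and ab: "0 \<le> a" "0 \<le> b"
    and le: "(\<integral>\<omega>. (norm (X \<omega>))\<^sup>2 \<partial>M) \<le> a\<^sup>2" "(\<integral>\<omega>. (norm (Y \<omega>))\<^sup>2 \<partial>M) \<le> b\<^sup>2"
    using X Y by (auto simp: l2_le_def)
  note int = sq_integrableD(2)[OF si(1)] sq_integrableD(2)[OF si(2)]
    sq_integrableD(2)[OF sq_integrable_add[OF si]]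
  have eps: "(\<integral>\<omega>. (norm (X \<omega> + Y \<omega>))\<^sup>2 \<partial>M) \<le> (a + b + 2 * e)\<^sup>2" if e: "e > 0" for e
  proof -
    \<comment> \<open>The bounds may be zero; the positive slack keeps the ratios defined and tends
      to zero at the end.\<close>
    define p q where "p = a + e" and "q = b + e"
    have pq: "0 < p" "0 < q" using ab e by (auto simp: p_def q_def)
    have "(\<integral>\<omega>. (norm (X \<omega> + Y \<omega>))\<^sup>2 \<partial>M) \<le> (\<integral>\<omega>. (1 + q / p) * (norm (X \<omega>))\<^sup>2 + (1 + p / q) * (norm (Y \<omega>))\<^sup>2 \<partial>M)"
    proof (rule integral_mono)
      fix \<omega>
      have "0 \<le> (norm (q *\<^sub>R X \<omega> - p *\<^sub>R Y \<omega>))\<^sup>2 / (p * q)" using pq by simp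
      also have "\<dots> = q / p * (norm (X \<omega>))\<^sup>2 + p / q * (norm (Y \<omega>))\<^sup>2 - 2 * (X \<omega> \<bullet> Y \<omega>)"
        using pq unfolding power2_norm_eq_inner
        by (simp add: inner_diff_left inner_diff_right inner_commute[of "Y \<omega>" "X \<omega>"] field_simps)
      finally show "(norm (X \<omega> + Y \<omega>))\<^sup>2 \<le> (1 + q / p) * (norm (X \<omega>))\<^sup>2 + (1 + p / q) * (norm (Y \<omega>))\<^sup>2"
        unfolding power2_norm_eq_inner
        by (simp add: inner_add_left inner_add_right inner_commute[of "Y \<omega>" "X \<omega>"] distrib_right)
    qed (use int in simp_all)
    also have "\<dots> = (1 + q / p) * (\<integral>\<omega>. (norm (X \<omega>))\<^sup>2 \<partial>M) + (1 + p / q) * (\<integral>\<omega>. (norm (Y \<omega>))\<^sup>2 \<partial>M)"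
      using int by simp
    also have "\<dots> \<le> (1 + q / p) * p\<^sup>2 + (1 + p / q) * q\<^sup>2"
    proof (intro add_mono mult_left_mono)
      show "(\<integral>\<omega>. (norm (X \<omega>))\<^sup>2 \<partial>M) \<le> p\<^sup>2"
        using ab e by (intro order_trans[OF le(1)] power_mono) (auto simp: p_def)
      show "(\<integral>\<omega>. (norm (Y \<omega>))\<^sup>2 \<partial>M) \<le> q\<^sup>2"
        using ab e by (intro order_trans[OF le(2)] power_mono) (auto simp: q_def)
    qed (use pq in auto)
    also have "\<dots> = (p + q)\<^sup>2" using pq by (simp add: field_simps power2_eq_square)
    finally show ?thesis by (simp add: p_def q_def algebra_simps)
  qed
  have "sqrt (\<integral>\<omega>. (norm (X \<omega> + Y \<omega>))\<^sup>2 \<partial>M) \<le> a + b"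
  proof (rule field_le_epsilon)
    fix e :: real assume "e > 0"
    from eps[of "e / 2"] this show "sqrt (\<integral>\<omega>. (norm (X \<omega> + Y \<omega>))\<^sup>2 \<partial>M) \<le> a + b + e"
      using ab by (intro real_le_lsqrt) auto
  qed
  then have "(\<integral>\<omega>. (norm (X \<omega> + Y \<omega>))\<^sup>2 \<partial>M) \<le> (a + b)\<^sup>2" by (rule sqrt_le_D)
  with ab show ?thesis using sq_integrable_add[OF si] by (simp add: l2_le_def)
qed

lemma l2_le_dominated:
  assumes X: "l2_le M X a" and c: "0 \<le> c" and Y: "Y \<in> borel_measurable M"
    and le: "\<And>\<omega>. \<omega> \<in> space M \<Longrightarrow> norm (Y \<omega>) \<le> c * norm (X \<omega>)"
  shows "l2_le M Y (c * a)"
proof -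
  have si: "sq_integrable M X" "0 \<le> a" "(\<integral>\<omega>. (norm (X \<omega>))\<^sup>2 \<partial>M) \<le> a\<^sup>2" using X by (auto simp: l2_le_def)
  have sY: "sq_integrable M Y" by (rule sq_integrable_dominated[OF si(1) Y le])
  have "(\<integral>\<omega>. (norm (Y \<omega>))\<^sup>2 \<partial>M) \<le> (\<integral>\<omega>. c\<^sup>2 * (norm (X \<omega>))\<^sup>2 \<partial>M)"
  proof (rule integral_mono)
    fix \<omega> assume "\<omega> \<in> space M"
    then have "(norm (Y \<omega>))\<^sup>2 \<le> (c * norm (X \<omega>))\<^sup>2" using le by (intro power_mono) auto
    then show "(norm (Y \<omega>))\<^sup>2 \<le> c\<^sup>2 * (norm (X \<omega>))\<^sup>2" by (simp add: power_mult_distrib)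
  qed (use sq_integrableD(2)[OF si(1)] sq_integrableD(2)[OF sY] in auto)
  also have "\<dots> \<le> c\<^sup>2 * a\<^sup>2" using si by (simp add: mult_left_mono)
  finally show ?thesis using sY si c by (simp add: l2_le_def power_mult_distrib)
qed

lemma l2_le_scaleR: "l2_le M X a \<Longrightarrow> l2_le M (\<lambda>\<omega>. c *\<^sub>R X \<omega>) (\<bar>c\<bar> * a)"
  by (rule l2_le_dominated) (auto simp: l2_le_def sq_integrable_def)

lemma l2_le_diff: "l2_le M X a \<Longrightarrow> l2_le M Y b \<Longrightarrow> l2_le M (\<lambda>\<omega>. X \<omega> - Y \<omega>) (a + b)"
  using l2_le_add[OF _ l2_le_scaleR[of M Y b "- 1"], of X a] by simp

section \<open>Joint measurability of the stochastic gradient\<close>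

text \<open>The argument \<open>y\<close> is replaced by the first point of a dense sequence within
  \<open>1 / (k + 1)\<close> of it. For fixed \<open>k\<close> this takes countably many values,
  each on a measurable set, so measurability in \<open>s\<close> suffices; continuity in
  \<open>y\<close> gives the limit.\<close>

lemma borel_measurable_caratheodory:
  fixes f :: "'a::euclidean_space \<Rightarrow> 's \<Rightarrow> real"
  assumes f[measurable]: "\<And>y. f y \<in> borel_measurable Z"
    and cont: "\<And>s y. s \<in> space Z \<Longrightarrow> isCont (\<lambda>u. f u s) y"
  shows "(\<lambda>(y, s). f y s) \<in> borel_measurable (borel \<Otimes>\<^sub>M Z)"
proof -
  obtain B :: "'a set" where B: "countable B" "\<And>X. open X \<Longrightarrow> X \<noteq> {} \<Longrightarrow> \<exists>d\<in>B. d \<in> X"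
    using countable_dense_exists by blast
  have "B \<noteq> {}" using B(2)[of UNIV] by auto
  define d where "d = from_nat_into B"
  have d: "\<exists>n. dist (d n) y < e" if "e > 0" for y e
  proof -
    obtain x where "x \<in> B" "x \<in> ball y e" using B(2)[of "ball y e"] \<open>e > 0\<close> by auto
    moreover from this obtain n where "x = d n"
      using range_from_nat_into[OF \<open>B \<noteq> {}\<close> B(1)] unfolding d_def by blast
    ultimately show ?thesis by (auto simp: dist_commute)
  qed
  define N where "N k y = (LEAST n. dist (d n) y < inverse (real (Suc k)))" for k :: nat and y
  have N: "dist (d (N k y)) y < inverse (real (Suc k))" for k y
    unfolding N_def by (rule LeastI_ex) (use d in simp)
  have [measurable]: "N k \<in> measurable borel (count_space UNIV)" for k
    unfolding N_def by measurable
  have lim: "(\<lambda>k. f (d (N k y)) s) \<longlonglongrightarrow> f y s" if "s \<in> space Z" for y s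
  proof -
    have "(\<lambda>k. d (N k y)) \<longlonglongrightarrow> y"
    proof (rule metric_tendsto_imp_tendsto)
      show "(\<lambda>k. inverse (real (Suc k))) \<longlonglongrightarrow> 0" by (rule LIMSEQ_inverse_real_of_nat)
      show "\<forall>\<^sub>F k in sequentially. dist (d (N k y)) y \<le> dist (inverse (real (Suc k))) 0"
        using N less_imp_le by (auto simp: dist_real_def intro!: always_eventually)
    qed
    then show ?thesis using cont[OF that] by (rule isCont_tendsto_compose[rotated])
  qed
  show ?thesis
  proof (rule borel_measurable_LIMSEQ_real)
    show "(\<lambda>k. case p of (y, s) \<Rightarrow> f (d (N k y)) s) \<longlonglongrightarrow> (case p of (y, s) \<Rightarrow> f y s)"
      if "p \<in> space (borel \<Otimes>\<^sub>M Z)" for p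
      using that lim by (auto simp: space_pair_measure)
    show "(\<lambda>p. case p of (y, s) \<Rightarrow> f (d (N k y)) s) \<in> borel_measurable (borel \<Otimes>\<^sub>M Z)" for k
      unfolding split_beta'
    proof (rule measurable_compose_countable[where g = "\<lambda>p. N k (fst p)"])
      show "(\<lambda>x. N k (fst x)) \<in> borel \<Otimes>\<^sub>M Z \<rightarrow>\<^sub>M count_space UNIV" by measurable
    qed measurable
  qed
qed

text \<open>Each coordinate of the gradient is the pointwise limit of difference quotients, which
  are jointly measurable because a differentiable function is continuous in
  \<open>y\<close>.\<close>

lemma borel_measurable_sgrad:
  fixes f :: "'a::euclidean_space \<Rightarrow> 's \<Rightarrow> real"
  assumes f: "\<And>y. f y \<in> borel_measurable Z"
    and diff: "\<And>s y. s \<in> space Z \<Longrightarrow> (\<lambda>u. f u s) differentiable (at y)"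
  shows "(\<lambda>(y, s). sgrad f y s) \<in> borel_measurable (borel \<Otimes>\<^sub>M Z)"
proof -
  have joint[measurable]: "(\<lambda>p. f (fst p) (snd p)) \<in> borel_measurable (borel \<Otimes>\<^sub>M Z)"
    using borel_measurable_caratheodory[of f Z, OF f] diff[THEN differentiable_imp_continuous_within]
    by (simp add: split_beta')
  define q where "q b k p = real (Suc k) * (f (fst p + inverse (real (Suc k)) *\<^sub>R b) (snd p) - f (fst p) (snd p))"
    for b :: 'a and k :: nat and p
  have q: "(\<lambda>k. q b k p) \<longlonglongrightarrow> sgrad f (fst p) (snd p) \<bullet> b" if "snd p \<in> space Z" for b p
  proof -
    have "((\<lambda>u. f u (snd p)) has_derivative (\<lambda>h. h \<bullet> sgrad f (fst p) (snd p))) (at (fst p))"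
      using differentiable_imp_GDERIV[OF diff[OF that]] unfolding gderiv_def sgrad_def .
    moreover have "((\<lambda>r. fst p + r *\<^sub>R b) has_derivative (\<lambda>r. r *\<^sub>R b)) (at 0)"
      by (auto intro!: derivative_eq_intros)
    ultimately have "((\<lambda>r. f (fst p + r *\<^sub>R b) (snd p)) has_derivative (\<lambda>r. (r *\<^sub>R b) \<bullet> sgrad f (fst p) (snd p))) (at 0)"
      by (intro has_derivative_compose[where f = "\<lambda>r. fst p + r *\<^sub>R b" and g = "\<lambda>u. f u (snd p)"]) auto
    moreover have "(\<lambda>r. (r *\<^sub>R b) \<bullet> sgrad f (fst p) (snd p)) = (*) (sgrad f (fst p) (snd p) \<bullet> b)"
      by (auto simp: fun_eq_iff inner_commute)
    ultimately have "((\<lambda>r. f (fst p + r *\<^sub>R b) (snd p)) has_field_derivative (sgrad f (fst p) (snd p) \<bullet> b)) (at 0)"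
      unfolding has_field_derivative_def by simp
    then have "((\<lambda>r. (f (fst p + r *\<^sub>R b) (snd p) - f (fst p) (snd p)) / r) \<longlongrightarrow> sgrad f (fst p) (snd p) \<bullet> b) (at 0)"
      by (simp add: has_field_derivative_iff)
    moreover have "filterlim (\<lambda>k. inverse (real (Suc k))) (at 0) sequentially"
      unfolding filterlim_at using LIMSEQ_inverse_real_of_nat by auto
    ultimately have "(\<lambda>k. (f (fst p + inverse (real (Suc k)) *\<^sub>R b) (snd p) - f (fst p) (snd p)) / inverse (real (Suc k)))
       \<longlonglongrightarrow> sgrad f (fst p) (snd p) \<bullet> b" by (rule filterlim_compose)
    then show ?thesis by (simp add: q_def divide_inverse mult.commute)
  qed
  have qm: "q b k \<in> borel_measurable (borel \<Otimes>\<^sub>M Z)" for b k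
  proof -
    have "(\<lambda>p. (fst p + inverse (real (Suc k)) *\<^sub>R b, snd p)) \<in> borel \<Otimes>\<^sub>M Z \<rightarrow>\<^sub>M borel \<Otimes>\<^sub>M Z" by measurable
    from measurable_compose[OF this joint]
    have [measurable]: "(\<lambda>p. f (fst p + inverse (real (Suc k)) *\<^sub>R b) (snd p)) \<in> borel_measurable (borel \<Otimes>\<^sub>M Z)" by simp
    show ?thesis unfolding q_def by measurable
  qed
  show ?thesis unfolding split_beta'
  proof (subst borel_measurable_euclidean_space, intro ballI)
    fix b :: 'a
    show "(\<lambda>p. sgrad f (fst p) (snd p) \<bullet> b) \<in> borel_measurable (borel \<Otimes>\<^sub>M Z)"
      by (rule borel_measurable_LIMSEQ_real[OF _ qm]) (use q in \<open>auto simp: space_pair_measure\<close>)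
  qed
qed

section \<open>Sample paths of M-CSER\<close>

locale mcser_alg =
  fixes f :: "'a::euclidean_space \<Rightarrow> 'z \<Rightarrow> real" and n :: nat and C1 C2 :: "'a \<Rightarrow> 'a" and H :: nat
    and \<beta> \<eta> :: real and x0 :: 'a
  assumes n: "n \<ge> 1"
begin

definition x :: "(nat \<Rightarrow> nat \<Rightarrow> 'z) \<Rightarrow> nat \<Rightarrow> nat \<Rightarrow> 'a" where
  "x \<zeta> t = fst (mcser f n C1 C2 H \<beta> \<eta> x0 \<zeta> t)"

definition e :: "(nat \<Rightarrow> nat \<Rightarrow> 'z) \<Rightarrow> nat \<Rightarrow> nat \<Rightarrow> 'a" where
  "e \<zeta> t = fst (snd (mcser f n C1 C2 H \<beta> \<eta> x0 \<zeta> t))"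

definition m :: "(nat \<Rightarrow> nat \<Rightarrow> 'z) \<Rightarrow> nat \<Rightarrow> nat \<Rightarrow> 'a" where
  "m \<zeta> t = snd (snd (mcser f n C1 C2 H \<beta> \<eta> x0 \<zeta> t))"

text \<open>The index is that of the iterate: \<open>g\<close>, \<open>p\<close> and
  \<open>eh\<close> at \<open>t\<close> belong to iteration \<open>t + 1\<close>. Thus
  \<open>g\<close> at \<open>t\<close> is the only new random input between the states at
  \<open>t\<close> and \<open>Suc t\<close>.\<close>

definition g :: "(nat \<Rightarrow> nat \<Rightarrow> 'z) \<Rightarrow> nat \<Rightarrow> nat \<Rightarrow> 'a" where
  "g \<zeta> t i = sgrad f (x \<zeta> t i) (\<zeta> i (Suc t))"

definition p :: "(nat \<Rightarrow> nat \<Rightarrow> 'z) \<Rightarrow> nat \<Rightarrow> nat \<Rightarrow> 'a" where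
  "p \<zeta> t i = \<eta> *\<^sub>R (\<beta> *\<^sub>R m \<zeta> (Suc t) i + g \<zeta> t i)"

definition eh :: "(nat \<Rightarrow> nat \<Rightarrow> 'z) \<Rightarrow> nat \<Rightarrow> nat \<Rightarrow> 'a" where
  "eh \<zeta> t i = e \<zeta> t i - (p \<zeta> t i - C2 (p \<zeta> t i))"

lemma init: "x \<zeta> 0 i = x0" "e \<zeta> 0 i = 0" "m \<zeta> 0 i = 0"
  by (simp_all add: x_def e_def m_def)

lemma m_Suc: "m \<zeta> (Suc t) i = \<beta> *\<^sub>R m \<zeta> t i + g \<zeta> t i"
  by (simp add: m_def g_def x_def Let_def split: prod.splits)

lemma e_Suc: "e \<zeta> (Suc t) i = (if H dvd Suc t then eh \<zeta> t i - C1 (eh \<zeta> t i) else eh \<zeta> t i)"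
  unfolding eh_def p_def m_Suc by (simp add: e_def m_def g_def x_def Let_def psync_def split: prod.splits)

lemma x_Suc:
  "x \<zeta> (Suc t) i = x \<zeta> t i - avg n (\<lambda>k. C2 (p \<zeta> t k)) - (p \<zeta> t i - C2 (p \<zeta> t i))
     + (if H dvd Suc t then avg n (\<lambda>k. C1 (eh \<zeta> t k)) - C1 (eh \<zeta> t i) else 0)"
  unfolding eh_def p_def m_Suc
  by (simp add: e_def m_def g_def x_def Let_def psync_def algebra_simps split: prod.splits)

text \<open>Each PSync preserves the mean of the vectors it is given: the residuals add back what
  compression removed. So neither compressor appears here.\<close>

lemma avg_x_Suc:
  "avg n (x \<zeta> (Suc t)) = avg n (x \<zeta> t) - \<eta> *\<^sub>R (\<beta> *\<^sub>R avg n (m \<zeta> (Suc t)) + avg n (g \<zeta> t))"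
proof -
  have "avg n (x \<zeta> (Suc t)) = avg n (x \<zeta> t) - avg n (p \<zeta> t)"
    unfolding x_Suc[abs_def] using n by (cases "H dvd Suc t") (simp_all add: avg_add avg_diff avg_const)
  then show ?thesis by (simp add: p_def[abs_def] avg_add avg_scaleR)
qed

lemma avg_m_Suc: "avg n (m \<zeta> (Suc t)) = \<beta> *\<^sub>R avg n (m \<zeta> t) + avg n (g \<zeta> t)"
  by (simp add: m_Suc[abs_def] avg_add avg_scaleR)

text \<open>Whatever a worker keeps for itself enters \<open>x\<close> and \<open>e\<close> alike,
  and whatever enters only \<open>x\<close> is an average shared by all. As the difference starts
  equal, it stays equal.\<close>

lemma x_minus_e_eq: "x \<zeta> t i - e \<zeta> t i = x \<zeta> t j - e \<zeta> t j"
proof (induction t)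
  case (Suc t)
  have "x \<zeta> (Suc t) i - e \<zeta> (Suc t) i = (x \<zeta> t i - e \<zeta> t i) - avg n (\<lambda>k. C2 (p \<zeta> t k))
     + (if H dvd Suc t then avg n (\<lambda>k. C1 (eh \<zeta> t k)) else 0)" for i
    by (simp add: x_Suc e_Suc eh_def algebra_simps)
  then show ?case using Suc by simp
qed (simp add: init)

lemma x_minus_avg: "x \<zeta> t i - avg n (x \<zeta> t) = e \<zeta> t i - avg n (e \<zeta> t)"
proof -
  have "avg n (\<lambda>j. x \<zeta> t j - e \<zeta> t j) = avg n (\<lambda>j. x \<zeta> t i - e \<zeta> t i)"
    by (rule avg_cong) (rule x_minus_e_eq)
  then show ?thesis using n by (simp add: avg_diff avg_const algebra_simps)
qed

lemma measurable_avg: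
  assumes "\<And>i. i \<in> {1..n} \<Longrightarrow> h i \<in> borel_measurable N"
  shows "(\<lambda>\<omega>. avg n (\<lambda>i. h i \<omega>) :: 'a) \<in> borel_measurable N"
  unfolding avg_def using assms by (intro borel_measurable_scaleR borel_measurable_sum) auto

text \<open>The \<sigma>-algebra \<open>N\<close> is arbitrary because this is needed for the whole
  probability space and for the one generated by all samples but one.\<close>

lemma measurable_state:
  assumes C: "C1 \<in> borel_measurable borel" "C2 \<in> borel_measurable borel"
    and sg: "(\<lambda>(y, s). sgrad f y s) \<in> borel_measurable (borel \<Otimes>\<^sub>M Z)"
    and \<zeta>: "\<And>j s. j \<in> {1..n} \<Longrightarrow> s \<in> {1..t} \<Longrightarrow> (\<lambda>\<omega>. \<zeta> \<omega> j s) \<in> N \<rightarrow>\<^sub>M Z"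
  shows "i \<in> {1..n} \<Longrightarrow> (\<lambda>\<omega>. x (\<zeta> \<omega>) t i) \<in> borel_measurable N \<and>
    (\<lambda>\<omega>. e (\<zeta> \<omega>) t i) \<in> borel_measurable N \<and> (\<lambda>\<omega>. m (\<zeta> \<omega>) t i) \<in> borel_measurable N"
  using \<zeta>
proof (induction t arbitrary: i)
  case (Suc t)
  note meas = borel_measurable_add borel_measurable_diff borel_measurable_scaleR borel_measurable_const
  have IH: "(\<lambda>\<omega>. x (\<zeta> \<omega>) t i) \<in> borel_measurable N" "(\<lambda>\<omega>. e (\<zeta> \<omega>) t i) \<in> borel_measurable N"
    "(\<lambda>\<omega>. m (\<zeta> \<omega>) t i) \<in> borel_measurable N" if "i \<in> {1..n}" for i
    using Suc.IH[OF that] Suc.prems(2) by auto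
  have g: "(\<lambda>\<omega>. g (\<zeta> \<omega>) t i) \<in> borel_measurable N" if i: "i \<in> {1..n}" for i
  proof -
    have "(\<lambda>\<omega>. (x (\<zeta> \<omega>) t i, \<zeta> \<omega> i (Suc t))) \<in> N \<rightarrow>\<^sub>M borel \<Otimes>\<^sub>M Z"
      using IH(1)[OF i] Suc.prems(2)[OF i, of "Suc t"] by (intro measurable_Pair) auto
    from measurable_compose[OF this sg] show ?thesis by (simp add: g_def)
  qed
  have m: "(\<lambda>\<omega>. m (\<zeta> \<omega>) (Suc t) i) \<in> borel_measurable N" if "i \<in> {1..n}" for i
    unfolding m_Suc by (intro meas IH g that)
  have p: "(\<lambda>\<omega>. p (\<zeta> \<omega>) t i) \<in> borel_measurable N" if "i \<in> {1..n}" for i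
    unfolding p_def by (intro meas m g that)
  have p2: "(\<lambda>\<omega>. C2 (p (\<zeta> \<omega>) t i)) \<in> borel_measurable N" if "i \<in> {1..n}" for i
    using p[OF that] C(2) by (rule measurable_compose)
  have eh: "(\<lambda>\<omega>. eh (\<zeta> \<omega>) t i) \<in> borel_measurable N" if "i \<in> {1..n}" for i
    unfolding eh_def by (intro meas IH p p2 that)
  have e1: "(\<lambda>\<omega>. C1 (eh (\<zeta> \<omega>) t i)) \<in> borel_measurable N" if "i \<in> {1..n}" for i
    using eh[OF that] C(1) by (rule measurable_compose)
  have av: "(\<lambda>\<omega>. avg n (\<lambda>k. C2 (p (\<zeta> \<omega>) t k))) \<in> borel_measurable N"
    "(\<lambda>\<omega>. avg n (\<lambda>k. C1 (eh (\<zeta> \<omega>) t k))) \<in> borel_measurable N"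
    by (intro measurable_avg p2 e1; assumption)+
  have "(\<lambda>\<omega>. e (\<zeta> \<omega>) (Suc t) i) \<in> borel_measurable N" if "i \<in> {1..n}" for i
    unfolding e_Suc by (cases "H dvd Suc t"; simp only: if_True if_False) (intro meas eh e1 that)+
  moreover have "(\<lambda>\<omega>. x (\<zeta> \<omega>) (Suc t) i) \<in> borel_measurable N" if "i \<in> {1..n}" for i
    unfolding x_Suc by (cases "H dvd Suc t"; simp only: if_True if_False) (intro meas IH p p2 av e1 that)+
  ultimately show ?case using m Suc.prems(1) by blast
qed (simp add: init)

end

lemma approx_compressorD:
  assumes "approx_compressor \<delta> C"
  shows "norm (v - C v) \<le> sqrt (1 - \<delta>) * norm v" "0 \<le> \<delta>" "\<delta> \<le> 1"
proof -
  show "0 \<le> \<delta>" "\<delta> \<le> 1" using assms by (auto simp: approx_compressor_def)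
  have "(norm (C v - v))\<^sup>2 \<le> (1 - \<delta>) * (norm v)\<^sup>2" using assms by (simp add: approx_compressor_def)
  then have "norm (C v - v) \<le> sqrt ((1 - \<delta>) * (norm v)\<^sup>2)" by (rule real_le_rsqrt)
  then show "norm (v - C v) \<le> sqrt (1 - \<delta>) * norm v" by (simp add: real_sqrt_mult norm_minus_commute)
qed

text \<open>The invariant charges \<open>H\<^sup>2\<close> per step of a completed period and
  \<open>r ^ 3\<close> to the \<open>r\<close> steps of the current one; it is preserved as
  \<open>3 * r\<^sup>2 \<le> (r + 1) ^ 3 - r ^ 3\<close>, and the two charges agree when a period
  closes.\<close>

lemma sum_mod_sqr_le:
  fixes H :: nat
  assumes "H > 0"
  shows "3 * (\<Sum>t<T. (real (t mod H))\<^sup>2) \<le> real T * (real H)\<^sup>2"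
proof -
  have inv: "3 * (\<Sum>t<T. (real (t mod H))\<^sup>2) \<le> (real T - real (T mod H)) * (real H)\<^sup>2 + real (T mod H) ^ 3"
  proof (induction T)
    case (Suc T)
    define r where "r = real (T mod H)"
    have r: "0 \<le> r" by (simp add: r_def)
    have "3 * (\<Sum>t<Suc T. (real (t mod H))\<^sup>2) \<le> (real T - r) * (real H)\<^sup>2 + (r + 1) ^ 3"
      using Suc r by (simp add: r_def power2_eq_square power3_eq_cube algebra_simps)
    also have "\<dots> = (real (Suc T) - real (Suc T mod H)) * (real H)\<^sup>2 + real (Suc T mod H) ^ 3"
    proof (cases "Suc (T mod H) = H")
      case True
      then have H: "r + 1 = real H" unfolding r_def by linarith
      have "(r + 1) ^ 3 = (r + 1) * (real H)\<^sup>2" by (simp add: H power2_eq_square power3_eq_cube)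
      moreover have "Suc T mod H = 0" using True by (simp add: mod_Suc)
      ultimately show ?thesis by (simp add: algebra_simps)
    next
      case False
      then have "real (Suc T mod H) = r + 1" by (simp add: mod_Suc r_def)
      then show ?thesis by simp
    qed
    finally show ?case .
  qed simp
  define r where "r = real (T mod H)"
  have r: "0 \<le> r" "r \<le> real H" using assms by (auto simp: r_def less_imp_le)
  have "r ^ 3 \<le> r * (real H)\<^sup>2"
    using r power_mono[of r "real H" 2] mult_left_mono[of "r\<^sup>2" "(real H)\<^sup>2" r] by (simp add: power2_eq_square power3_eq_cube)
  then show ?thesis using inv unfolding r_def[symmetric] by (simp add: algebra_simps)
qed

section \<open>Independent sampling\<close>

locale mcser_sampling = prob_space M + mcser_alg f n C1 C2 H \<beta> \<eta> x0
  for M :: "'w measure" and f :: "'a::euclidean_space \<Rightarrow> 'z \<Rightarrow> real" and n C1 C2 H \<beta> \<eta> x0 +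
  fixes Z :: "'z measure" and D :: "nat \<Rightarrow> 'z measure" and z :: "nat \<Rightarrow> nat \<Rightarrow> 'w \<Rightarrow> 'z"
    and T :: nat and \<delta>1 \<delta>2 L V1 V1' :: real
  assumes H: "H > 0" and T: "T \<ge> 1" and \<beta>: "0 \<le> \<beta>" "\<beta> < 1" and L: "L > 0"
    and \<eta>: "0 < \<eta>" "\<eta> \<le> (1 - \<beta>) / (2 * L)"
    and C1: "approx_compressor \<delta>1 C1" "C1 \<in> borel_measurable borel" and \<delta>1: "0 < \<delta>1"
    and C2: "approx_compressor \<delta>2 C2" "C2 \<in> borel_measurable borel"
    and D: "\<And>i. i \<in> {1..n} \<Longrightarrow> prob_space (D i)" "\<And>i. i \<in> {1..n} \<Longrightarrow> sets (D i) = sets Z"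
    and f_measurable: "\<And>y. f y \<in> borel_measurable Z"
    and f_differentiable: "\<And>s y. s \<in> space Z \<Longrightarrow> (\<lambda>u. f u s) differentiable (at y)"
    and sgrad_unbiased: "\<And>i y. i \<in> {1..n} \<Longrightarrow>
      has_bochner_integral (D i) (sgrad f y) (gradient (local_obj f D i) y)"
    and z_indep: "indep_vars (\<lambda>_. Z) (\<lambda>(i, t). z i t) ({1..n} \<times> {1..T})"
    and z_distr: "\<And>i t. i \<in> {1..n} \<Longrightarrow> t \<in> {1..T} \<Longrightarrow> distr M Z (z i t) = D i"
    and smooth: "\<And>i. i \<in> {1..n} \<Longrightarrow> L_smooth L (local_obj f D i)"
    and noise: "\<And>i t. i \<in> {1..n} \<Longrightarrow> t < T \<Longrightarrow>
      integrable M (\<lambda>\<omega>. (norm (g (\<lambda>j s. z j s \<omega>) t i - gradient (local_obj f D i) (x (\<lambda>j s. z j s \<omega>) t i)))\<^sup>2)"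
      "\<And>i t. i \<in> {1..n} \<Longrightarrow> t < T \<Longrightarrow>
      (\<integral>\<omega>. (norm (g (\<lambda>j s. z j s \<omega>) t i - gradient (local_obj f D i) (x (\<lambda>j s. z j s \<omega>) t i)))\<^sup>2 \<partial>M) \<le> V1"
    and grad_bound: "\<And>i t. i \<in> {1..n} \<Longrightarrow> t < T \<Longrightarrow>
      (AE \<omega> in M. (norm (gradient (local_obj f D i) (x (\<lambda>j s. z j s \<omega>) t i)))\<^sup>2 \<le> V1')"
begin

abbreviation \<zeta> :: "'w \<Rightarrow> nat \<Rightarrow> nat \<Rightarrow> 'z" where "\<zeta> \<omega> \<equiv> \<lambda>j s. z j s \<omega>"

abbreviation dF :: "nat \<Rightarrow> 'a \<Rightarrow> 'a" where "dF i \<equiv> gradient (local_obj f D i)"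

definition \<xi> :: "nat \<Rightarrow> nat \<Rightarrow> 'w \<Rightarrow> 'a" where "\<xi> t i \<omega> = g (\<zeta> \<omega>) t i - dF i (x (\<zeta> \<omega>) t i)"

definition V2 where "V2 = V1 + V1'"

lemma sgrad_measurable: "(\<lambda>(y, s). sgrad f y s) \<in> borel_measurable (borel \<Otimes>\<^sub>M Z)"
  using f_measurable f_differentiable by (rule borel_measurable_sgrad)

lemma z_measurable: "i \<in> {1..n} \<Longrightarrow> t \<in> {1..T} \<Longrightarrow> z i t \<in> M \<rightarrow>\<^sub>M Z"
  using z_indep by (auto simp: indep_vars_def)

lemma dF_lipschitz: "i \<in> {1..n} \<Longrightarrow> norm (dF i u - dF i v) \<le> L * norm (u - v)"
  using L smooth by (intro L_smooth_imp_lipschitz_gradient) auto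

lemma dF_measurable: "i \<in> {1..n} \<Longrightarrow> dF i \<in> borel_measurable borel"
  by (rule borel_measurable_lipschitz) (rule dF_lipschitz)

text \<open>Leaving out the single sample \<open>(i, t)\<close>, instead of keeping only the past of \<open>t\<close>, makes the fresh gradients of
  the other workers measurable as well, which gives the factor \<open>1 / n\<close> in the variance of the mean noise.\<close>

definition others :: "nat \<Rightarrow> nat \<Rightarrow> 'w measure" where
  "others i t = vimage_algebra (space M)
     (\<lambda>\<omega>. \<lambda>q\<in>{1..n} \<times> {1..T} - {(i, t)}. (case q of (j, s) \<Rightarrow> z j s) \<omega>)
     (PiM ({1..n} \<times> {1..T} - {(i, t)}) (\<lambda>_. Z))"

lemma others_measurable_z:
  assumes "j \<in> {1..n}" "s \<in> {1..T}" "(j, s) \<noteq> (i, t)"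
  shows "z j s \<in> others i t \<rightarrow>\<^sub>M Z"
proof -
  let ?J = "{1..n} \<times> {1..T} - {(i, t)}"
  have "(\<lambda>\<omega>. \<lambda>q\<in>?J. (case q of (j, s) \<Rightarrow> z j s) \<omega>) \<in> M \<rightarrow>\<^sub>M PiM ?J (\<lambda>_. Z)"
  proof (rule measurable_restrict)
    fix q assume "q \<in> ?J"
    then show "(case q of (j, s) \<Rightarrow> z j s) \<in> M \<rightarrow>\<^sub>M Z" by (cases q) (simp add: z_measurable)
  qed
  then have "(\<lambda>\<omega>. \<lambda>q\<in>?J. (case q of (j, s) \<Rightarrow> z j s) \<omega>) \<in> space M \<rightarrow> space (PiM ?J (\<lambda>_. Z))"
    unfolding measurable_def by (elim CollectE conjE)
  then have Y: "(\<lambda>\<omega>. \<lambda>q\<in>?J. (case q of (j, s) \<Rightarrow> z j s) \<omega>) \<in> others i t \<rightarrow>\<^sub>M PiM ?J (\<lambda>_. Z)"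
    unfolding others_def by (rule measurable_vimage_algebra1)
  have "(\<lambda>h. h (j, s)) \<in> PiM ?J (\<lambda>_. Z) \<rightarrow>\<^sub>M Z"
    using assms by (intro measurable_component_singleton) auto
  from measurable_compose[OF Y this] show ?thesis using assms by simp
qed

text \<open>Independence of one sample from the rest, in the form that Fubini needs. The two laws
  are compared on rectangles, where both factors are events of the two independent blocks of
  samples.\<close>

lemma distr_others_pair:
  assumes i: "i \<in> {1..n}" "t \<in> {1..T}" and W: "W \<in> others i t \<rightarrow>\<^sub>M N" "W \<in> M \<rightarrow>\<^sub>M N"
  shows "distr M (N \<Otimes>\<^sub>M Z) (\<lambda>\<omega>. (W \<omega>, z i t \<omega>)) = distr M N W \<Otimes>\<^sub>M D i"
proof -
  let ?J = "{1..n} \<times> {1..T} - {(i, t)}"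
  let ?Y = "\<lambda>K \<omega>. \<lambda>q\<in>K. (case q of (j, s) \<Rightarrow> z j s) \<omega>"
  let ?\<sigma> = "\<lambda>K. sigma_sets (space M) {?Y K -` A \<inter> space M |A. A \<in> sets (PiM K (\<lambda>_. Z))}"
  have "indep_var (PiM ?J (\<lambda>_. Z)) (?Y ?J) (PiM {(i, t)} (\<lambda>_. Z)) (?Y {(i, t)})"
    by (rule indep_var_restrict[OF z_indep]) (use i in auto)
  then have ind: "indep_set (?\<sigma> ?J) (?\<sigma> {(i, t)})"
    unfolding indep_var_eq by auto
  have zM: "z i t \<in> M \<rightarrow>\<^sub>M Z" by (rule z_measurable[OF i])
  interpret W: prob_space "distr M N W" by (rule prob_space_distr) (fact W(2))
  interpret Di: prob_space "D i" by (rule D(1)[OF i(1)])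
  show ?thesis
  proof (rule pair_measure_eqI[symmetric])
    show "sigma_finite_measure (distr M N W)" "sigma_finite_measure (D i)" by unfold_locales
    show "sets (distr M N W \<Otimes>\<^sub>M D i) = sets (distr M (N \<Otimes>\<^sub>M Z) (\<lambda>\<omega>. (W \<omega>, z i t \<omega>)))"
      using D(2)[OF i(1)] by (simp cong: sets_pair_measure_cong)
    fix A B assume "A \<in> sets (distr M N W)" "B \<in> sets (D i)"
    then have A: "A \<in> sets N" and B: "B \<in> sets Z" using D(2)[OF i(1)] by auto
    have "W -` A \<inter> space (others i t) \<in> sets (others i t)" by (rule measurable_sets[OF W(1) A])
    then have a: "W -` A \<inter> space M \<in> ?\<sigma> ?J"
      unfolding others_def sets_vimage_algebra space_vimage_algebra .
    have b: "z i t -` B \<inter> space M \<in> ?\<sigma> {(i, t)}"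
    proof (rule sigma_sets.Basic, intro CollectI exI conjI)
      show "(\<lambda>h. h (i, t)) -` B \<inter> space (PiM {(i, t)} (\<lambda>_. Z)) \<in> sets (PiM {(i, t)} (\<lambda>_. Z))"
        using B by (intro measurable_sets[OF measurable_component_singleton]) auto
      show "z i t -` B \<inter> space M = ?Y {(i, t)} -` ((\<lambda>h. h (i, t)) -` B \<inter> space (PiM {(i, t)} (\<lambda>_. Z))) \<inter> space M"
        using measurable_space[OF zM] by (auto simp: space_PiM)
    qed
    have "emeasure (distr M (N \<Otimes>\<^sub>M Z) (\<lambda>\<omega>. (W \<omega>, z i t \<omega>))) (A \<times> B)
        = emeasure M ((\<lambda>\<omega>. (W \<omega>, z i t \<omega>)) -` (A \<times> B) \<inter> space M)"
      using A B W(2) zM by (intro emeasure_distr measurable_Pair) auto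
    also have "(\<lambda>\<omega>. (W \<omega>, z i t \<omega>)) -` (A \<times> B) \<inter> space M = (W -` A \<inter> space M) \<inter> (z i t -` B \<inter> space M)" by auto
    also have "emeasure M \<dots> = ennreal (prob (W -` A \<inter> space M) * prob (z i t -` B \<inter> space M))"
      using indep_setD[OF ind a b] by (simp add: emeasure_eq_measure)
    also have "\<dots> = emeasure (distr M N W) A * emeasure (distr M Z (z i t)) B"
      using A B W(2) zM by (simp add: emeasure_distr emeasure_eq_measure ennreal_mult)
    finally show "emeasure (distr M N W) A * emeasure (D i) B
       = emeasure (distr M (N \<Otimes>\<^sub>M Z) (\<lambda>\<omega>. (W \<omega>, z i t \<omega>))) (A \<times> B)"
      using z_distr[OF i] by simp
  qed
qed

lemma measurable_states:
  assumes "\<And>j s. j \<in> {1..n} \<Longrightarrow> s \<in> {1..t} \<Longrightarrow> z j s \<in> N \<rightarrow>\<^sub>M Z" "i \<in> {1..n}"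
  shows "(\<lambda>\<omega>. x (\<zeta> \<omega>) t i) \<in> borel_measurable N" "(\<lambda>\<omega>. e (\<zeta> \<omega>) t i) \<in> borel_measurable N"
    "(\<lambda>\<omega>. m (\<zeta> \<omega>) t i) \<in> borel_measurable N"
  using measurable_state[OF C1(2) C2(2) sgrad_measurable, of t \<zeta> N i] assms by auto

text \<open>Under the product law the fresh sample is integrated first. The iterate is then a fixed
  point, at which the stochastic gradient is unbiased.\<close>

lemma noise_orthogonal:
  assumes i: "i \<in> {1..n}" and t: "t < T"
    and \<phi>: "sq_integrable M \<phi>" "\<phi> \<in> borel_measurable (others i (Suc t))"
    and \<xi>: "sq_integrable M (\<xi> t i)"
  shows "(\<integral>\<omega>. \<phi> \<omega> \<bullet> \<xi> t i \<omega> \<partial>M) = 0"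
proof -
  have t': "Suc t \<in> {1..T}" using t by simp
  let ?N = "borel \<Otimes>\<^sub>M borel :: ('a \<times> 'a) measure"
  \<comment> \<open>The iterate is carried along with \<open>\<phi>\<close>, so that the integrand
    depends on \<open>\<omega>\<close> only through \<open>?W\<close> and the fresh sample.\<close>
  let ?W = "\<lambda>\<omega>. (\<phi> \<omega>, x (\<zeta> \<omega>) t i)"
  let ?k = "\<lambda>(w, s). fst w \<bullet> (sgrad f (snd w) s - dF i (snd w))"
  have xO: "(\<lambda>\<omega>. x (\<zeta> \<omega>) t i) \<in> borel_measurable (others i (Suc t))"
    using t i by (intro measurable_states others_measurable_z) auto
  have xM: "(\<lambda>\<omega>. x (\<zeta> \<omega>) t i) \<in> borel_measurable M"
    using t i by (intro measurable_states z_measurable) auto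
  have W: "?W \<in> others i (Suc t) \<rightarrow>\<^sub>M ?N" "?W \<in> M \<rightarrow>\<^sub>M ?N"
    using xO xM \<phi>(2) sq_integrableD(1)[OF \<phi>(1)] by (auto intro: measurable_Pair)
  note dist = distr_others_pair[OF i t' W]
  have zM: "z i (Suc t) \<in> M \<rightarrow>\<^sub>M Z" by (rule z_measurable[OF i t'])
  have WZ: "(\<lambda>\<omega>. (?W \<omega>, z i (Suc t) \<omega>)) \<in> M \<rightarrow>\<^sub>M ?N \<Otimes>\<^sub>M Z" using W(2) zM by (rule measurable_Pair)
  have k: "?k \<in> borel_measurable (?N \<Otimes>\<^sub>M Z)"
  proof -
    have "(\<lambda>q. (snd (fst q), snd q)) \<in> ?N \<Otimes>\<^sub>M Z \<rightarrow>\<^sub>M borel \<Otimes>\<^sub>M Z" by measurable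
    from measurable_compose[OF this sgrad_measurable]
    have [measurable]: "(\<lambda>q. sgrad f (snd (fst q)) (snd q)) \<in> borel_measurable (?N \<Otimes>\<^sub>M Z)" by simp
    note [measurable] = dF_measurable[OF i]
    show ?thesis unfolding split_beta' by measurable
  qed
  have keq: "?k (?W \<omega>, z i (Suc t) \<omega>) = \<phi> \<omega> \<bullet> \<xi> t i \<omega>" for \<omega> by (simp add: \<xi>_def g_def)
  interpret W: prob_space "distr M ?N ?W" by (rule prob_space_distr) (fact W(2))
  interpret Di: prob_space "D i" by (rule D(1)[OF i])
  interpret P: pair_sigma_finite "distr M ?N ?W" "D i" ..
  have "integrable (distr M (?N \<Otimes>\<^sub>M Z) (\<lambda>\<omega>. (?W \<omega>, z i (Suc t) \<omega>))) ?k"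
    using sq_integrable_inner[OF \<phi>(1) \<xi>] keq by (simp add: integrable_distr_eq[OF WZ k])
  then have int: "integrable (distr M ?N ?W \<Otimes>\<^sub>M D i) ?k" unfolding dist .
  have "(\<integral>\<omega>. \<phi> \<omega> \<bullet> \<xi> t i \<omega> \<partial>M) = integral\<^sup>L (distr M (?N \<Otimes>\<^sub>M Z) (\<lambda>\<omega>. (?W \<omega>, z i (Suc t) \<omega>))) ?k"
    unfolding integral_distr[OF WZ k] keq ..
  also have "\<dots> = (\<integral>w. (\<integral>s. ?k (w, s) \<partial>D i) \<partial>distr M ?N ?W)"
    unfolding dist by (rule P.integral_fst'[OF int, symmetric])
  also have "(\<lambda>w. \<integral>s. ?k (w, s) \<partial>D i) = (\<lambda>w. 0)"
  proof
    fix w :: "'a \<times> 'a"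
    have "has_bochner_integral (D i) (\<lambda>s. fst w \<bullet> (sgrad f (snd w) s - dF i (snd w))) (fst w \<bullet> (dF i (snd w) - dF i (snd w)))"
      using sgrad_unbiased[OF i, of "snd w"]
      by (intro has_bochner_integral_inner_right has_bochner_integral_diff)
         (auto simp: has_bochner_integral_iff Di.prob_space)
    then show "(\<integral>s. ?k (w, s) \<partial>D i) = 0" by (simp add: has_bochner_integral_integral_eq)
  qed
  finally show ?thesis by simp
qed

lemma g_measurable:
  assumes "\<And>j s. j \<in> {1..n} \<Longrightarrow> s \<in> {1..Suc t} \<Longrightarrow> z j s \<in> N \<rightarrow>\<^sub>M Z" "i \<in> {1..n}"
  shows "(\<lambda>\<omega>. g (\<zeta> \<omega>) t i) \<in> borel_measurable N"
proof -
  \<comment> \<open>The gradient is read off as the increment of the momentum, whose measurability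
    is already known.\<close>
  have "(\<lambda>\<omega>. m (\<zeta> \<omega>) (Suc t) i - \<beta> *\<^sub>R m (\<zeta> \<omega>) t i) \<in> borel_measurable N"
    using assms by (intro borel_measurable_diff borel_measurable_scaleR borel_measurable_const measurable_states) auto
  then show ?thesis by (simp add: m_Suc)
qed

lemma dF_x_measurable:
  assumes "\<And>j s. j \<in> {1..n} \<Longrightarrow> s \<in> {1..t} \<Longrightarrow> z j s \<in> N \<rightarrow>\<^sub>M Z" "i \<in> {1..n}"
  shows "(\<lambda>\<omega>. dF i (x (\<zeta> \<omega>) t i)) \<in> borel_measurable N"
  by (rule measurable_compose[OF _ dF_measurable]) (use assms in \<open>auto intro: measurable_states\<close>)

lemma \<xi>_measurable:
  assumes "\<And>j s. j \<in> {1..n} \<Longrightarrow> s \<in> {1..Suc t} \<Longrightarrow> z j s \<in> N \<rightarrow>\<^sub>M Z" "i \<in> {1..n}"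
  shows "\<xi> t i \<in> borel_measurable N"
  unfolding \<xi>_def[abs_def] using assms by (intro borel_measurable_diff g_measurable dF_x_measurable) auto

section \<open>Second moments along the sample paths\<close>

lemma sq_integrable_\<xi>:
  assumes "i \<in> {1..n}" "t < T"
  shows "sq_integrable M (\<xi> t i)"
  using noise(1)[OF assms] assms unfolding sq_integrable_def
  by (auto intro!: \<xi>_measurable z_measurable simp: \<xi>_def)

lemma sq_integrable_residual:
  assumes C: "approx_compressor \<delta> C" "C \<in> borel_measurable borel" and X: "sq_integrable M X"
  shows "sq_integrable M (\<lambda>\<omega>. X \<omega> - C (X \<omega>))"
proof (rule sq_integrable_dominated[OF X])
  show "norm (X \<omega> - C (X \<omega>)) \<le> sqrt (1 - \<delta>) * norm (X \<omega>)" for \<omega> by (rule approx_compressorD(1)[OF C(1)])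
  have "(\<lambda>\<omega>. C (X \<omega>)) \<in> borel_measurable M" using sq_integrableD(1)[OF X] C(2) by (rule measurable_compose)
  then show "(\<lambda>\<omega>. X \<omega> - C (X \<omega>)) \<in> borel_measurable M" by (intro borel_measurable_diff sq_integrableD(1)[OF X])
qed

lemma sq_integrable_compressed:
  assumes C: "approx_compressor \<delta> C" "C \<in> borel_measurable borel" and X: "sq_integrable M X"
  shows "sq_integrable M (\<lambda>\<omega>. C (X \<omega>))"
  using sq_integrable_diff[OF X sq_integrable_residual[OF C X]] by simp

text \<open>A stochastic gradient is square-integrable noise plus a Lipschitz function of the
  iterate, and a compression residual is no longer than its input; both preserve square
  integrability.\<close>

lemma sq_integrable_states:
  "t \<le> T \<Longrightarrow> i \<in> {1..n} \<Longrightarrow> sq_integrable M (\<lambda>\<omega>. x (\<zeta> \<omega>) t i) \<and>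
     sq_integrable M (\<lambda>\<omega>. e (\<zeta> \<omega>) t i) \<and> sq_integrable M (\<lambda>\<omega>. m (\<zeta> \<omega>) t i)"
proof (induction t arbitrary: i)
  case 0
  then show ?case by (simp add: init sq_integrable_const)
next
  case (Suc t)
  have IH: "sq_integrable M (\<lambda>\<omega>. x (\<zeta> \<omega>) t i)" "sq_integrable M (\<lambda>\<omega>. e (\<zeta> \<omega>) t i)"
    "sq_integrable M (\<lambda>\<omega>. m (\<zeta> \<omega>) t i)" if "i \<in> {1..n}" for i
    using Suc.IH[OF _ that] Suc.prems(1) by auto
  have g: "sq_integrable M (\<lambda>\<omega>. g (\<zeta> \<omega>) t i)" if i: "i \<in> {1..n}" for i
    using sq_integrable_add[OF sq_integrable_\<xi>[OF i, of t] sq_integrable_lipschitz[OF IH(1)[OF i] dF_lipschitz[OF i]]]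
      Suc.prems(1) by (simp add: \<xi>_def)
  have m: "sq_integrable M (\<lambda>\<omega>. m (\<zeta> \<omega>) (Suc t) i)" if i: "i \<in> {1..n}" for i
    unfolding m_Suc by (intro sq_integrable_add sq_integrable_scaleR IH g i)
  have p: "sq_integrable M (\<lambda>\<omega>. p (\<zeta> \<omega>) t i)" if i: "i \<in> {1..n}" for i
    unfolding p_def by (intro sq_integrable_add sq_integrable_scaleR m g i)
  have eh: "sq_integrable M (\<lambda>\<omega>. eh (\<zeta> \<omega>) t i)" if i: "i \<in> {1..n}" for i
    unfolding eh_def by (intro sq_integrable_diff[OF IH(2)[OF i]] sq_integrable_residual[OF C2] p i)
  have p2: "sq_integrable M (\<lambda>\<omega>. C2 (p (\<zeta> \<omega>) t i))" if i: "i \<in> {1..n}" for i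
    by (rule sq_integrable_compressed[OF C2 p[OF i]])
  have e1: "sq_integrable M (\<lambda>\<omega>. C1 (eh (\<zeta> \<omega>) t i))" if i: "i \<in> {1..n}" for i
    by (rule sq_integrable_compressed[OF C1 eh[OF i]])
  have av: "sq_integrable M (\<lambda>\<omega>. avg n (\<lambda>k. C2 (p (\<zeta> \<omega>) t k)))"
    "sq_integrable M (\<lambda>\<omega>. avg n (\<lambda>k. C1 (eh (\<zeta> \<omega>) t k)))"
    by (intro sq_integrable_avg p2; assumption) (intro sq_integrable_avg e1; assumption)
  note i = Suc.prems(2)
  have "sq_integrable M (\<lambda>\<omega>. e (\<zeta> \<omega>) (Suc t) i)"
    unfolding e_Suc by (cases "H dvd Suc t"; simp only: if_True if_False) (intro sq_integrable_diff eh e1 i)+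
  moreover have "sq_integrable M (\<lambda>\<omega>. x (\<zeta> \<omega>) (Suc t) i)"
    unfolding x_Suc by (cases "H dvd Suc t"; simp only: if_True if_False)
      (intro sq_integrable_add sq_integrable_diff sq_integrable_const IH p p2 av e1 i)+
  ultimately show ?case using m[OF i] by blast
qed

lemma sq_integrable_dF_x: "t \<le> T \<Longrightarrow> i \<in> {1..n} \<Longrightarrow> sq_integrable M (\<lambda>\<omega>. dF i (x (\<zeta> \<omega>) t i))"
  by (rule sq_integrable_lipschitz[OF _ dF_lipschitz]) (use sq_integrable_states in auto)

lemma expectation_dF_sqr: "t < T \<Longrightarrow> i \<in> {1..n} \<Longrightarrow> (\<integral>\<omega>. (norm (dF i (x (\<zeta> \<omega>) t i)))\<^sup>2 \<partial>M) \<le> V1'"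
  by (rule integral_le_const) (auto intro!: sq_integrableD(2) sq_integrable_dF_x grad_bound)

lemma V_nonneg: "0 \<le> V1" "0 \<le> V1'" "0 \<le> V2"
proof -
  have 1: "1 \<in> {1..n}" "0 < T" using n T by auto
  show "0 \<le> V1" by (rule order_trans[OF _ noise(2)[OF 1]]) simp
  moreover show "0 \<le> V1'" by (rule order_trans[OF _ expectation_dF_sqr[OF 1(2,1)]]) simp
  ultimately show "0 \<le> V2" by (simp add: V2_def)
qed

text \<open>Noise and local gradient are orthogonal in L2, so their bounds add without a
  constant.\<close>

lemma l2_le_g:
  assumes t: "t < T" and i: "i \<in> {1..n}"
  shows "l2_le M (\<lambda>\<omega>. g (\<zeta> \<omega>) t i) (sqrt V2)"
proof -
  let ?h = "\<lambda>\<omega>. dF i (x (\<zeta> \<omega>) t i)"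
  have sh: "sq_integrable M ?h" using t i by (intro sq_integrable_dF_x) auto
  have s\<xi>: "sq_integrable M (\<xi> t i)" by (rule sq_integrable_\<xi>[OF i t])
  have gs: "(\<lambda>\<omega>. g (\<zeta> \<omega>) t i) = (\<lambda>\<omega>. \<xi> t i \<omega> + ?h \<omega>)" by (simp add: \<xi>_def fun_eq_iff)
  have "?h \<in> borel_measurable (others i (Suc t))"
    using t i by (intro dF_x_measurable others_measurable_z) auto
  then have orth: "(\<integral>\<omega>. ?h \<omega> \<bullet> \<xi> t i \<omega> \<partial>M) = 0"
    by (intro noise_orthogonal[OF i t sh _ s\<xi>])
  have "(\<lambda>\<omega>. (norm (\<xi> t i \<omega> + ?h \<omega>))\<^sup>2) = (\<lambda>\<omega>. (norm (\<xi> t i \<omega>))\<^sup>2 + (norm (?h \<omega>))\<^sup>2 + 2 * (?h \<omega> \<bullet> \<xi> t i \<omega>))"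
    unfolding power2_norm_eq_inner by (auto simp: inner_add_left inner_add_right inner_commute)
  then have "(\<integral>\<omega>. (norm (\<xi> t i \<omega> + ?h \<omega>))\<^sup>2 \<partial>M)
      = (\<integral>\<omega>. (norm (\<xi> t i \<omega>))\<^sup>2 \<partial>M) + (\<integral>\<omega>. (norm (?h \<omega>))\<^sup>2 \<partial>M) + 2 * (\<integral>\<omega>. ?h \<omega> \<bullet> \<xi> t i \<omega> \<partial>M)"
    using sq_integrableD(2)[OF sh] sq_integrableD(2)[OF s\<xi>] sq_integrable_inner[OF sh s\<xi>] by simp
  also have "\<dots> \<le> V1 + V1'"
    using noise(2)[OF i t] expectation_dF_sqr[OF t i] orth by (simp add: \<xi>_def)
  finally show ?thesis
    unfolding l2_le_def gs using sq_integrable_add[OF s\<xi> sh] V_nonneg by (simp add: V2_def)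
qed

text \<open>In the expanded square the products for different workers have mean zero, so only
  \<open>n\<close> of the \<open>n\<^sup>2\<close> terms survive.\<close>

lemma expectation_avg_noise:
  assumes t: "t < T"
  shows "(\<integral>\<omega>. (norm (avg n (\<lambda>i. \<xi> t i \<omega>)))\<^sup>2 \<partial>M) \<le> V1 / real n"
proof -
  have eq: "(norm (avg n (\<lambda>i. \<xi> t i \<omega>)))\<^sup>2 = (\<Sum>i=1..n. \<Sum>j=1..n. \<xi> t i \<omega> \<bullet> \<xi> t j \<omega>) / (real n)\<^sup>2" for \<omega>
  proof -
    have "(\<Sum>i=1..n. \<xi> t i \<omega>) \<bullet> (\<Sum>j=1..n. \<xi> t j \<omega>) = (\<Sum>i=1..n. \<Sum>j=1..n. \<xi> t i \<omega> \<bullet> \<xi> t j \<omega>)"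
      by (subst inner_sum_left) (simp only: inner_sum_right)
    then show ?thesis
      unfolding power2_norm_eq_inner avg_def by (simp add: power2_eq_square)
  qed
  have int: "integrable M (\<lambda>\<omega>. \<xi> t i \<omega> \<bullet> \<xi> t j \<omega>)" if "i \<in> {1..n}" "j \<in> {1..n}" for i j
    using that t by (intro sq_integrable_inner sq_integrable_\<xi>) auto
  have zero: "(\<integral>\<omega>. \<xi> t i \<omega> \<bullet> \<xi> t j \<omega> \<partial>M) = 0" if ij: "i \<in> {1..n}" "j \<in> {1..n}" "i \<noteq> j" for i j
  proof (rule noise_orthogonal[OF ij(2) t sq_integrable_\<xi>[OF ij(1) t] _ sq_integrable_\<xi>[OF ij(2) t]])
    \<comment> \<open>\<open>g_measurable\<close> would demand the samples of all workers at time
      \<open>Suc t\<close>, including the one that is left out. The gradient of worker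
      \<open>i\<close> needs only its own fresh sample.\<close>
    have "g (\<zeta> \<omega>) t i = sgrad f (x (\<zeta> \<omega>) t i) (z i (Suc t) \<omega>)" for \<omega> by (simp add: g_def)
    moreover have "(\<lambda>\<omega>. (x (\<zeta> \<omega>) t i, z i (Suc t) \<omega>)) \<in> others j (Suc t) \<rightarrow>\<^sub>M borel \<Otimes>\<^sub>M Z"
      using ij t by (intro measurable_Pair measurable_states others_measurable_z) auto
    from measurable_compose[OF this sgrad_measurable]
    have "(\<lambda>\<omega>. sgrad f (x (\<zeta> \<omega>) t i) (z i (Suc t) \<omega>)) \<in> borel_measurable (others j (Suc t))" by simp
    moreover have "(\<lambda>\<omega>. dF i (x (\<zeta> \<omega>) t i)) \<in> borel_measurable (others j (Suc t))"
      using ij t by (intro dF_x_measurable others_measurable_z) auto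
    ultimately show "\<xi> t i \<in> borel_measurable (others j (Suc t))"
      unfolding \<xi>_def[abs_def] by simp
  qed
  have "(\<integral>\<omega>. (norm (avg n (\<lambda>i. \<xi> t i \<omega>)))\<^sup>2 \<partial>M)
      = (\<Sum>i=1..n. \<Sum>j=1..n. (\<integral>\<omega>. \<xi> t i \<omega> \<bullet> \<xi> t j \<omega> \<partial>M)) / (real n)\<^sup>2"
  proof -
    have "(\<integral>\<omega>. (\<Sum>i=1..n. \<Sum>j=1..n. \<xi> t i \<omega> \<bullet> \<xi> t j \<omega>) \<partial>M) = (\<Sum>i=1..n. (\<integral>\<omega>. (\<Sum>j=1..n. \<xi> t i \<omega> \<bullet> \<xi> t j \<omega>) \<partial>M))"
      by (rule Bochner_Integration.integral_sum) (intro Bochner_Integration.integrable_sum int; assumption)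
    also have "\<dots> = (\<Sum>i=1..n. \<Sum>j=1..n. (\<integral>\<omega>. \<xi> t i \<omega> \<bullet> \<xi> t j \<omega> \<partial>M))"
      by (intro sum.cong refl Bochner_Integration.integral_sum int)
    finally show ?thesis unfolding eq by simp
  qed
  also have "(\<Sum>i=1..n. \<Sum>j=1..n. (\<integral>\<omega>. \<xi> t i \<omega> \<bullet> \<xi> t j \<omega> \<partial>M))
      = (\<Sum>i=1..n. \<Sum>j=1..n. if j = i then (\<integral>\<omega>. (norm (\<xi> t i \<omega>))\<^sup>2 \<partial>M) else 0)"
    using zero by (intro sum.cong refl) (auto simp: power2_norm_eq_inner)
  also have "\<dots> = (\<Sum>i=1..n. (\<integral>\<omega>. (norm (\<xi> t i \<omega>))\<^sup>2 \<partial>M))" by (simp add: sum.delta)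
  also have "\<dots> \<le> (\<Sum>i=1..n. V1)"
    using noise(2)[OF _ t] by (intro sum_mono) (simp add: \<xi>_def)
  finally show ?thesis using n by (simp add: divide_right_mono power2_eq_square field_simps)
qed

section \<open>Size of the momentum and of the error\<close>

definition q :: real where "q = sqrt (1 - \<delta>1)"

text \<open>Bounds in L2 what one iteration adds to the error of a worker: the residual factor of
  \<open>C2\<close> times the bound on \<open>p\<close>.\<close>

definition R :: real where "R = sqrt (1 - \<delta>2) * (\<eta> * (sqrt V2 / (1 - \<beta>)))"

lemma q: "0 \<le> q" "q < 1"
  using \<delta>1 approx_compressorD(3)[OF C1(1)] by (auto simp: q_def)

lemma R: "0 \<le> R"
  using approx_compressorD(3)[OF C2(1)] \<eta> \<beta> V_nonneg by (simp add: R_def)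

text \<open>The bound is the fixed point of
  \<open>a \<mapsto> \<beta> * a + sqrt V2\<close>.\<close>

lemma l2_le_m: "t \<le> T \<Longrightarrow> i \<in> {1..n} \<Longrightarrow> l2_le M (\<lambda>\<omega>. m (\<zeta> \<omega>) t i) (sqrt V2 / (1 - \<beta>))"
proof (induction t)
  case 0
  have "l2_le M (\<lambda>\<omega>. 0 :: 'a) (sqrt V2 / (1 - \<beta>))"
    using V_nonneg \<beta> by (intro l2_le_mono[OF l2_le_zero]) simp
  then show ?case by (simp add: init)
next
  case (Suc t)
  have "l2_le M (\<lambda>\<omega>. m (\<zeta> \<omega>) (Suc t) i) (\<bar>\<beta>\<bar> * (sqrt V2 / (1 - \<beta>)) + sqrt V2)"
    unfolding m_Suc using Suc by (intro l2_le_add l2_le_scaleR l2_le_g) auto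
  also have "\<bar>\<beta>\<bar> * (sqrt V2 / (1 - \<beta>)) + sqrt V2 = sqrt V2 / (1 - \<beta>)"
    using \<beta> by (simp add: field_simps)
  finally show ?case .
qed

lemma l2_le_residual:
  assumes C: "approx_compressor \<delta> C" "C \<in> borel_measurable borel" and X: "l2_le M X a"
  shows "l2_le M (\<lambda>\<omega>. X \<omega> - C (X \<omega>)) (sqrt (1 - \<delta>) * a)"
proof (rule l2_le_dominated[OF X])
  have "sq_integrable M X" using X by (simp add: l2_le_def)
  from sq_integrableD(1)[OF sq_integrable_residual[OF C this]]
  show "(\<lambda>\<omega>. X \<omega> - C (X \<omega>)) \<in> borel_measurable M" .
  show "norm (X \<omega> - C (X \<omega>)) \<le> sqrt (1 - \<delta>) * norm (X \<omega>)" for \<omega> by (rule approx_compressorD(1)[OF C(1)])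
  show "0 \<le> sqrt (1 - \<delta>)" using approx_compressorD(3)[OF C(1)] by simp
qed

text \<open>Within a period the error grows by at most \<open>R\<close> per iteration; a
  synchronization multiplies the error accumulated so far by \<open>q\<close>.\<close>

lemma l2_le_e:
  "t \<le> T \<Longrightarrow> i \<in> {1..n} \<Longrightarrow> l2_le M (\<lambda>\<omega>. e (\<zeta> \<omega>) t i) ((q / (1 - q) * real H + real (t mod H)) * R)"
proof (induction t)
  case 0
  have "l2_le M (\<lambda>\<omega>. 0 :: 'a) ((q / (1 - q) * real H + real (0 mod H)) * R)"
    using R q by (intro l2_le_mono[OF l2_le_zero]) simp
  then show ?case by (simp add: init)
next
  case (Suc t)
  let ?y = "q / (1 - q)"
  have "l2_le M (\<lambda>\<omega>. p (\<zeta> \<omega>) t i) (\<bar>\<eta>\<bar> * (\<bar>\<beta>\<bar> * (sqrt V2 / (1 - \<beta>)) + sqrt V2))"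
    unfolding p_def using Suc.prems by (intro l2_le_add l2_le_scaleR l2_le_g l2_le_m) auto
  also have "\<bar>\<eta>\<bar> * (\<bar>\<beta>\<bar> * (sqrt V2 / (1 - \<beta>)) + sqrt V2) = \<eta> * (sqrt V2 / (1 - \<beta>))"
    using \<beta> \<eta> by (simp add: field_simps)
  finally have "l2_le M (\<lambda>\<omega>. p (\<zeta> \<omega>) t i - C2 (p (\<zeta> \<omega>) t i)) R"
    unfolding R_def by (rule l2_le_residual[OF C2])
  then have "l2_le M (\<lambda>\<omega>. eh (\<zeta> \<omega>) t i) ((?y * real H + real (t mod H)) * R + R)"
    unfolding eh_def using Suc by (intro l2_le_diff) auto
  also have "(?y * real H + real (t mod H)) * R + R = (?y * real H + real (Suc (t mod H))) * R"
    by (simp add: algebra_simps)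
  finally have eh: "l2_le M (\<lambda>\<omega>. eh (\<zeta> \<omega>) t i) ((?y * real H + real (Suc (t mod H))) * R)" .
  show ?case
  proof (cases "H dvd Suc t")
    case True
    then have 0: "Suc t mod H = 0" by simp
    then have "Suc (t mod H) = H" using H by (simp add: mod_Suc split: if_splits)
    then have "l2_le M (\<lambda>\<omega>. eh (\<zeta> \<omega>) t i - C1 (eh (\<zeta> \<omega>) t i)) (q * ((?y * real H + real H) * R))"
      using l2_le_residual[OF C1 eh] by (simp add: q_def)
    \<comment> \<open>The bound right after a synchronization is the fixed point of
      \<open>a \<mapsto> q * (a + H * R)\<close>.\<close>
    also have "q * ((?y * real H + real H) * R) = (?y * real H + real (Suc t mod H)) * R"
      using q 0 by (simp add: field_simps)
    finally show ?thesis using True by (simp add: e_Suc)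
  next
    case False
    then have "Suc t mod H \<noteq> 0" by (simp add: dvd_eq_mod_eq_0)
    then have "Suc t mod H = Suc (t mod H)" by (simp add: mod_Suc split: if_splits)
    then show ?thesis using eh False by (simp add: e_Suc)
  qed
qed

section \<open>The bias of the averaged gradient\<close>

lemma global_smooth:
  "L_smooth L (global_obj f D n)" "gradient (global_obj f D n) v = avg n (\<lambda>i. dF i v)"
  using L_smooth_avg[OF n smooth] by (simp_all add: global_obj_def[abs_def])

definition dFx :: "nat \<Rightarrow> 'w \<Rightarrow> 'a" where "dFx t \<omega> = avg n (\<lambda>i. dF i (x (\<zeta> \<omega>) t i))"

definition bias :: "nat \<Rightarrow> 'w \<Rightarrow> 'a" where
  "bias t \<omega> = dFx t \<omega> - gradient (global_obj f D n) (avg n (x (\<zeta> \<omega>) t))"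

text \<open>The distance of a worker from the average iterate is that of its error from the average
  error, by \<open>x_minus_avg\<close>; averaged over the workers, removing the mean only decreases
  the squares.\<close>

lemma bias_sqr_le: "(norm (bias t \<omega>))\<^sup>2 \<le> L\<^sup>2 * avg n (\<lambda>i. (norm (e (\<zeta> \<omega>) t i))\<^sup>2)"
proof -
  let ?xb = "avg n (x (\<zeta> \<omega>) t)"
  have "bias t \<omega> = avg n (\<lambda>i. dF i (x (\<zeta> \<omega>) t i) - dF i ?xb)"
    by (simp add: bias_def dFx_def global_smooth avg_diff)
  then have "(norm (bias t \<omega>))\<^sup>2 \<le> avg n (\<lambda>i. (norm (dF i (x (\<zeta> \<omega>) t i) - dF i ?xb))\<^sup>2)"
    using norm_avg_sqr_le[OF n] by simp
  also have "\<dots> \<le> avg n (\<lambda>i. L\<^sup>2 *\<^sub>R (norm (x (\<zeta> \<omega>) t i - ?xb))\<^sup>2)"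
  proof (rule avg_mono)
    fix i assume "i \<in> {1..n}"
    then have "(norm (dF i (x (\<zeta> \<omega>) t i) - dF i ?xb))\<^sup>2 \<le> (L * norm (x (\<zeta> \<omega>) t i - ?xb))\<^sup>2"
      by (intro power_mono dF_lipschitz) auto
    then show "(norm (dF i (x (\<zeta> \<omega>) t i) - dF i ?xb))\<^sup>2 \<le> L\<^sup>2 *\<^sub>R (norm (x (\<zeta> \<omega>) t i - ?xb))\<^sup>2"
      by (simp add: power_mult_distrib)
  qed
  also have "\<dots> = L\<^sup>2 * avg n (\<lambda>i. (norm (e (\<zeta> \<omega>) t i - avg n (e (\<zeta> \<omega>) t)))\<^sup>2)"
    unfolding avg_scaleR x_minus_avg by simp
  also have "\<dots> \<le> L\<^sup>2 * avg n (\<lambda>i. (norm (e (\<zeta> \<omega>) t i))\<^sup>2)"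
    using avg_norm_minus_avg[OF n, of "e (\<zeta> \<omega>) t"] by (intro mult_left_mono) auto
  finally show ?thesis .
qed

lemma sq_integrable_avg_x: "t \<le> T \<Longrightarrow> sq_integrable M (\<lambda>\<omega>. avg n (x (\<zeta> \<omega>) t))"
  by (rule sq_integrable_avg) (use sq_integrable_states in auto)

lemma sq_integrable_avg_m: "t \<le> T \<Longrightarrow> sq_integrable M (\<lambda>\<omega>. avg n (m (\<zeta> \<omega>) t))"
  by (rule sq_integrable_avg) (use sq_integrable_states in auto)

lemma sq_integrable_dFx: "t \<le> T \<Longrightarrow> sq_integrable M (dFx t)"
  unfolding dFx_def[abs_def] by (intro sq_integrable_avg sq_integrable_dF_x) auto

lemma sq_integrable_grad:
  assumes "sq_integrable M X"
  shows "sq_integrable M (\<lambda>\<omega>. gradient (global_obj f D n) (X \<omega>))"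
  using L by (intro sq_integrable_lipschitz[OF assms, where c = L] L_smooth_imp_lipschitz_gradient[OF global_smooth(1)]) auto

lemma sq_integrable_bias: "t \<le> T \<Longrightarrow> sq_integrable M (bias t)"
  unfolding bias_def[abs_def] by (intro sq_integrable_diff sq_integrable_dFx sq_integrable_grad sq_integrable_avg_x)

lemma expectation_bias:
  assumes t: "t \<le> T"
  shows "(\<integral>\<omega>. (norm (bias t \<omega>))\<^sup>2 \<partial>M) \<le> L\<^sup>2 * ((q / (1 - q) * real H + real (t mod H)) * R)\<^sup>2"
proof -
  let ?b = "((q / (1 - q) * real H + real (t mod H)) * R)\<^sup>2"
  have e: "integrable M (\<lambda>\<omega>. (norm (e (\<zeta> \<omega>) t i))\<^sup>2)" "(\<integral>\<omega>. (norm (e (\<zeta> \<omega>) t i))\<^sup>2 \<partial>M) \<le> ?b"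
    if "i \<in> {1..n}" for i
    using l2_le_e[OF t that] by (auto simp: l2_le_def sq_integrable_def)
  have int: "integrable M (\<lambda>\<omega>. avg n (\<lambda>i. (norm (e (\<zeta> \<omega>) t i))\<^sup>2))"
    unfolding avg_def using e(1) by (intro integrable_scaleR_right Bochner_Integration.integrable_sum) auto
  have "(\<integral>\<omega>. (norm (bias t \<omega>))\<^sup>2 \<partial>M) \<le> (\<integral>\<omega>. L\<^sup>2 * avg n (\<lambda>i. (norm (e (\<zeta> \<omega>) t i))\<^sup>2) \<partial>M)"
    using int sq_integrableD(2)[OF sq_integrable_bias[OF t]] bias_sqr_le by (intro integral_mono) auto
  also have "\<dots> = L\<^sup>2 * avg n (\<lambda>i. \<integral>\<omega>. (norm (e (\<zeta> \<omega>) t i))\<^sup>2 \<partial>M)"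
    using e(1) by (simp add: avg_def)
  also have "\<dots> \<le> L\<^sup>2 * avg n (\<lambda>i. ?b)"
    using e(2) by (intro mult_left_mono avg_mono) auto
  finally show ?thesis using n by (simp add: avg_const)
qed

lemma sum_expectation_bias:
  "3 / 2 * (\<Sum>t<T. (\<integral>\<omega>. (norm (bias t \<omega>))\<^sup>2 \<partial>M))
     \<le> real T * (((q / (1 - q))\<^sup>2 + 1) * (2 * L\<^sup>2 * (real H)\<^sup>2 * R\<^sup>2))"
proof -
  let ?y = "q / (1 - q)"
  have "(\<Sum>t<T. (\<integral>\<omega>. (norm (bias t \<omega>))\<^sup>2 \<partial>M))
      \<le> (\<Sum>t<T. L\<^sup>2 * R\<^sup>2 * (4 / 3 * ?y\<^sup>2 * (real H)\<^sup>2 + 4 * (real (t mod H))\<^sup>2))"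
  proof (rule sum_mono)
    fix t assume "t \<in> {..<T}"
    then have "(\<integral>\<omega>. (norm (bias t \<omega>))\<^sup>2 \<partial>M) \<le> L\<^sup>2 * ((?y * real H + real (t mod H)) * R)\<^sup>2"
      by (intro expectation_bias) auto
    also have "\<dots> = L\<^sup>2 * R\<^sup>2 * (?y * real H + real (t mod H))\<^sup>2" by (simp add: power_mult_distrib)
    also have "\<dots> \<le> L\<^sup>2 * R\<^sup>2 * (4 / 3 * ?y\<^sup>2 * (real H)\<^sup>2 + 4 * (real (t mod H))\<^sup>2)"
    proof (rule mult_left_mono)
      \<comment> \<open>The weights are chosen to meet at the same constant:
        \<open>3 / 2 * 4 / 3 = 2\<close> for the first part, and \<open>3 / 2 * 4 / 3 = 2\<close>
        again for the second, as \<open>(t mod H)\<^sup>2\<close> averages to at most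
        \<open>H\<^sup>2 / 3\<close>.\<close>
      have sq: "(a + b)\<^sup>2 \<le> 4 / 3 * a\<^sup>2 + 4 * b\<^sup>2" for a b :: real
      proof -
        have "0 \<le> (a - 3 * b)\<^sup>2" by simp
        then show ?thesis by (simp add: power2_eq_square algebra_simps)
      qed
      show "(?y * real H + real (t mod H))\<^sup>2 \<le> 4 / 3 * ?y\<^sup>2 * (real H)\<^sup>2 + 4 * (real (t mod H))\<^sup>2"
        using sq[of "?y * real H" "real (t mod H)"] by (simp only: power_mult_distrib mult.assoc)
    qed simp
    finally show "(\<integral>\<omega>. (norm (bias t \<omega>))\<^sup>2 \<partial>M) \<le> L\<^sup>2 * R\<^sup>2 * (4 / 3 * ?y\<^sup>2 * (real H)\<^sup>2 + 4 * (real (t mod H))\<^sup>2)" .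
  qed
  also have "\<dots> = L\<^sup>2 * R\<^sup>2 * (4 / 3 * ?y\<^sup>2 * (real H)\<^sup>2 * real T + 4 / 3 * (3 * (\<Sum>t<T. (real (t mod H))\<^sup>2)))"
    by (simp add: sum_distrib_left[symmetric] sum.distrib)
  also have "\<dots> \<le> L\<^sup>2 * R\<^sup>2 * (4 / 3 * ?y\<^sup>2 * (real H)\<^sup>2 * real T + 4 / 3 * (real T * (real H)\<^sup>2))"
    using sum_mod_sqr_le[OF H, of T] by (intro mult_left_mono add_left_mono) auto
  finally show ?thesis by (simp add: algebra_simps)
qed

lemma measurable_avg_states:
  assumes "\<And>j s. j \<in> {1..n} \<Longrightarrow> s \<in> {1..t} \<Longrightarrow> z j s \<in> N \<rightarrow>\<^sub>M Z"
  shows "(\<lambda>\<omega>. avg n (x (\<zeta> \<omega>) t)) \<in> borel_measurable N" "(\<lambda>\<omega>. avg n (m (\<zeta> \<omega>) t)) \<in> borel_measurable N"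
    "dFx t \<in> borel_measurable N"
  unfolding dFx_def[abs_def]
  by (intro measurable_avg measurable_states dF_x_measurable assms; assumption)+

lemma grad_measurable: "gradient (global_obj f D n) \<in> borel_measurable borel"
  using L by (intro borel_measurable_lipschitz[where c = L] L_smooth_imp_lipschitz_gradient[OF global_smooth(1)]) auto

section \<open>Telescoping and expectation\<close>

lemma expectation_inner_avg_noise:
  assumes t: "t < T" and U: "sq_integrable M U" "\<And>i. i \<in> {1..n} \<Longrightarrow> U \<in> borel_measurable (others i (Suc t))"
  shows "(\<integral>\<omega>. U \<omega> \<bullet> avg n (\<lambda>i. \<xi> t i \<omega>) \<partial>M) = 0"
proof -
  have "(\<integral>\<omega>. U \<omega> \<bullet> avg n (\<lambda>i. \<xi> t i \<omega>) \<partial>M) = (\<integral>\<omega>. 1 / real n * (\<Sum>i=1..n. U \<omega> \<bullet> \<xi> t i \<omega>) \<partial>M)"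
    by (simp add: avg_def inner_sum_right)
  also have "\<dots> = 1 / real n * (\<Sum>i=1..n. (\<integral>\<omega>. U \<omega> \<bullet> \<xi> t i \<omega> \<partial>M))"
    using t by (subst integral_mult_right_zero, subst Bochner_Integration.integral_sum)
      (auto intro!: sq_integrable_inner U sq_integrable_\<xi>)
  also have "(\<Sum>i=1..n. (\<integral>\<omega>. U \<omega> \<bullet> \<xi> t i \<omega> \<partial>M)) = 0"
    by (intro sum.neutral ballI noise_orthogonal t U sq_integrable_\<xi>)
  finally show ?thesis by simp
qed

lemma sum_expectation_gradient:
  assumes xmin: "\<And>y. global_obj f D n xmin \<le> global_obj f D n y"
  shows "(\<Sum>t<T. (\<integral>\<omega>. (norm (gradient (global_obj f D n) (avg n (x (\<zeta> \<omega>) t))))\<^sup>2 \<partial>M))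
    \<le> 2 * (1 - \<beta>) * (global_obj f D n x0 - global_obj f D n xmin) / \<eta>
      + real T * (\<eta>\<^sup>2 * \<beta> ^ 4 * L\<^sup>2 * V2 / (1 - \<beta>) ^ 4)
      + real T * (\<eta> * L * V1 / (real n * (1 - \<beta>)))
      + real T * (((q / (1 - q))\<^sup>2 + 1) * (2 * L\<^sup>2 * (real H)\<^sup>2 * R\<^sup>2))"
proof -
  let ?F = "global_obj f D n"
  let ?xb = "\<lambda>t \<omega>. avg n (x (\<zeta> \<omega>) t)" and ?mb = "\<lambda>t \<omega>. avg n (m (\<zeta> \<omega>) t)"
    and ?\<xi>b = "\<lambda>t \<omega>. avg n (\<lambda>i. \<xi> t i \<omega>)"
  have b: "1 - \<beta> > 0" using \<beta> by simp
  define \<gamma> where "\<gamma> = \<eta> / (1 - \<beta>)"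
  define \<theta> where "\<theta> = L * \<gamma>"
  have \<gamma>: "0 < \<gamma>" using \<eta> b by (simp add: \<gamma>_def)
  \<comment> \<open>The bound \<open>1 / 2\<close> is exactly the step size condition.\<close>
  have \<theta>: "0 < \<theta>" "\<theta> \<le> 1 / 2"
    using \<gamma> L \<eta> b by (auto simp: \<theta>_def \<gamma>_def field_simps)
  define \<kappa> where "\<kappa> = \<theta> * \<beta>\<^sup>2 / (1 - \<beta>)"
  define A where "A = 1 - \<theta> * \<beta>\<^sup>2"
  obtain C where C: "0 \<le> C" "C * (1 - \<beta>)\<^sup>2 + \<theta> * A\<^sup>2 \<le> \<theta> + \<kappa>\<^sup>2"
    and Q: "\<And>m d :: 'a. 0 \<le> (1 - \<theta>) * (norm (m + A *\<^sub>R d))\<^sup>2 - 3 * (\<theta> * \<beta>\<^sup>2)\<^sup>2 * (norm d)\<^sup>2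
       - 2 * (1 - \<theta>) * \<kappa> * norm m * norm (m + A *\<^sub>R d)
       - C * (2 * (1 - \<beta>) * (m \<bullet> d) + (1 - \<beta>)\<^sup>2 * (norm d)\<^sup>2) + \<kappa>\<^sup>2 * (norm (m + d))\<^sup>2"
    unfolding A_def \<kappa>_def by (rule ex_momentum_weight[OF \<beta> \<theta>]) blast
  define y where "y x m = x - ((1 - \<theta>) * \<gamma> * \<beta>\<^sup>2) *\<^sub>R m" for x m :: 'a
  define \<Phi> where "\<Phi> t \<omega> = ?F (y (?xb t \<omega>) (?mb t \<omega>)) + \<gamma> / 2 * (C * (1 - \<beta>)\<^sup>2 * (norm (?mb t \<omega>))\<^sup>2)" for t \<omega>
  define U where "U t \<omega> = (let M = (1 - \<beta>) *\<^sub>R ?mb t \<omega>; G = dFx t \<omega> in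
      (2 * \<theta> * A) *\<^sub>R (M + A *\<^sub>R (G - M)) + (2 * C * (1 - \<beta>)) *\<^sub>R (M + (1 - \<beta>) *\<^sub>R (G - M))
          - (2 * A) *\<^sub>R gradient ?F (y (?xb t \<omega>) (?mb t \<omega>)))" for t \<omega>
  define c where "c = C * (1 - \<beta>)\<^sup>2 + \<theta> * A\<^sup>2"
  have c: "0 \<le> c" "c \<le> \<theta> + \<kappa>\<^sup>2" using C \<theta> by (auto simp: c_def)
  have step: "(norm (gradient ?F (?xb t \<omega>)))\<^sup>2 \<le> 2 / \<gamma> * (\<Phi> t \<omega> - \<Phi> (Suc t) \<omega>) + 3 / 2 * (norm (bias t \<omega>))\<^sup>2
      + \<kappa>\<^sup>2 * (norm (dFx t \<omega>))\<^sup>2 + c * (norm (?\<xi>b t \<omega>))\<^sup>2 + U t \<omega> \<bullet> ?\<xi>b t \<omega>" for t \<omega>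
  proof -
    have gb: "dFx t \<omega> + ?\<xi>b t \<omega> = avg n (g (\<zeta> \<omega>) t)"
      by (simp add: dFx_def \<xi>_def avg_add[symmetric])
    have xS: "?xb (Suc t) \<omega> = ?xb t \<omega> - ((1 - \<beta>) * \<gamma>) *\<^sub>R (\<beta> *\<^sub>R ?mb (Suc t) \<omega> + avg n (g (\<zeta> \<omega>) t))"
      using b by (simp add: avg_x_Suc \<gamma>_def)
    show ?thesis
      using momentum_step[OF global_smooth(1) L \<gamma> \<beta>(2), folded \<theta>_def, folded \<kappa>_def A_def, OF _ Q,
          of "?xb t \<omega>" "?mb t \<omega>" "dFx t \<omega>" "?\<xi>b t \<omega>"] \<theta>(2)
      unfolding gb xS \<Phi>_def U_def y_def c_def bias_def Let_def avg_m_Suc by simp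
  qed
  have sqs: "sq_integrable M (?xb t)" "sq_integrable M (?mb t)" "sq_integrable M (dFx t)" if "t < T" for t
    using that sq_integrable_avg_x sq_integrable_avg_m sq_integrable_dFx by auto
  have sq\<xi>: "sq_integrable M (?\<xi>b t)" if "t < T" for t
    by (intro sq_integrable_avg sq_integrable_\<xi> that)
  have sqU: "sq_integrable M (U t)" if "t < T" for t
    unfolding U_def[abs_def] Let_def y_def
    by (intro sq_integrable_add sq_integrable_diff sq_integrable_scaleR sq_integrable_grad sqs that)
  have U0: "(\<integral>\<omega>. U t \<omega> \<bullet> ?\<xi>b t \<omega> \<partial>M) = 0" if t: "t < T" for t
  proof (rule expectation_inner_avg_noise[OF t sqU[OF t]])
    fix i assume i: "i \<in> {1..n}"
    \<comment> \<open>\<open>U t\<close> is made of the state at time \<open>t\<close>, hence of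
      samples up to \<open>t\<close>; leaving out the one at \<open>Suc t\<close> removes nothing
      from it.\<close>
    have past: "z j s \<in> others i (Suc t) \<rightarrow>\<^sub>M Z" if "j \<in> {1..n}" "s \<in> {1..t}" for j s
      using that t by (intro others_measurable_z) auto
    note meas = measurable_avg_states[OF past]
    show "U t \<in> borel_measurable (others i (Suc t))"
      unfolding U_def[abs_def] Let_def y_def
      by (intro borel_measurable_add borel_measurable_diff borel_measurable_scaleR borel_measurable_const
          measurable_compose[OF _ grad_measurable] meas; assumption)
  qed
  define rhs where "rhs t \<omega> = 3 / 2 * (norm (bias t \<omega>))\<^sup>2
      + \<kappa>\<^sup>2 * (norm (dFx t \<omega>))\<^sup>2 + c * (norm (?\<xi>b t \<omega>))\<^sup>2 + U t \<omega> \<bullet> ?\<xi>b t \<omega>" for t \<omega>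
  have tel: "(\<Sum>t<T. (norm (gradient ?F (?xb t \<omega>)))\<^sup>2) \<le> 2 / \<gamma> * (?F x0 - ?F xmin) + (\<Sum>t<T. rhs t \<omega>)" for \<omega>
  proof -
    have "(\<Sum>t<T. (norm (gradient ?F (?xb t \<omega>)))\<^sup>2) \<le> (\<Sum>t<T. 2 / \<gamma> * (\<Phi> t \<omega> - \<Phi> (Suc t) \<omega>) + rhs t \<omega>)"
      using step by (intro sum_mono) (simp add: rhs_def add.assoc)
    also have "\<dots> = 2 / \<gamma> * (\<Phi> 0 \<omega> - \<Phi> T \<omega>) + (\<Sum>t<T. rhs t \<omega>)"
      by (simp only: sum.distrib sum_distrib_left[symmetric] sum_lessThan_telescope'[of "\<lambda>t. \<Phi> t \<omega>"])
    also have "\<Phi> 0 \<omega> = ?F x0"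
      using n by (simp add: \<Phi>_def y_def init[abs_def] avg_const)
    also have "2 / \<gamma> * (?F x0 - \<Phi> T \<omega>) \<le> 2 / \<gamma> * (?F x0 - ?F xmin)"
    proof -
      \<comment> \<open>The momentum energy is nonnegative, so the potential inherits the lower
        bound of the objective. At time 0 the momentum is zero and the potential is the objective
        itself.\<close>
      have "?F xmin \<le> \<Phi> T \<omega>"
        using xmin[of "y (?xb T \<omega>) (?mb T \<omega>)"] C(1) \<gamma> by (simp add: \<Phi>_def add_increasing2)
      then show ?thesis using \<gamma> by (intro mult_left_mono) auto
    qed
    finally show ?thesis by simp
  qed
  have int_grad: "integrable M (\<lambda>\<omega>. (norm (gradient ?F (?xb t \<omega>)))\<^sup>2)" if "t < T" for t
    using that by (intro sq_integrableD(2) sq_integrable_grad sq_integrable_avg_x) simp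
  have ints: "integrable M (\<lambda>\<omega>. (norm (bias t \<omega>))\<^sup>2)" "integrable M (\<lambda>\<omega>. (norm (dFx t \<omega>))\<^sup>2)"
    "integrable M (\<lambda>\<omega>. (norm (?\<xi>b t \<omega>))\<^sup>2)" "integrable M (\<lambda>\<omega>. U t \<omega> \<bullet> ?\<xi>b t \<omega>)" if t: "t < T" for t
    using t sq_integrableD(2)[OF sq_integrable_bias, of t] sq_integrableD(2)[OF sqs(3)[OF t]] sq_integrableD(2)[OF sq\<xi>[OF t]]
      sq_integrable_inner[OF sqU[OF t] sq\<xi>[OF t]] by auto
  have int_rhs: "integrable M (rhs t)" if "t < T" for t
    unfolding rhs_def[abs_def] using ints[OF that] by simp
  have rhs: "(\<integral>\<omega>. rhs t \<omega> \<partial>M) \<le> 3 / 2 * (\<integral>\<omega>. (norm (bias t \<omega>))\<^sup>2 \<partial>M) + (\<kappa>\<^sup>2 * V2 + \<theta> * (V1 / real n))" if t: "t < T" for t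
  proof -
    have "(\<integral>\<omega>. rhs t \<omega> \<partial>M) = 3 / 2 * (\<integral>\<omega>. (norm (bias t \<omega>))\<^sup>2 \<partial>M)
        + \<kappa>\<^sup>2 * (\<integral>\<omega>. (norm (dFx t \<omega>))\<^sup>2 \<partial>M) + c * (\<integral>\<omega>. (norm (?\<xi>b t \<omega>))\<^sup>2 \<partial>M)"
      unfolding rhs_def using ints[OF t] U0[OF t] by simp
    also have "\<dots> \<le> 3 / 2 * (\<integral>\<omega>. (norm (bias t \<omega>))\<^sup>2 \<partial>M) + \<kappa>\<^sup>2 * V1' + (\<theta> + \<kappa>\<^sup>2) * (V1 / real n)"
    proof (intro add_mono mult_left_mono order_refl)
      have "(\<integral>\<omega>. (norm (dFx t \<omega>))\<^sup>2 \<partial>M) \<le> (\<integral>\<omega>. avg n (\<lambda>i. (norm (dF i (x (\<zeta> \<omega>) t i)))\<^sup>2) \<partial>M)"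
      proof (rule integral_mono)
        show "integrable M (\<lambda>\<omega>. avg n (\<lambda>i. (norm (dF i (x (\<zeta> \<omega>) t i)))\<^sup>2))"
          unfolding avg_def using t
          by (intro integrable_scaleR_right Bochner_Integration.integrable_sum sq_integrableD(2) sq_integrable_dF_x) auto
      qed (use ints[OF t] norm_avg_sqr_le[OF n] in \<open>auto simp: dFx_def\<close>)
      also have "\<dots> = avg n (\<lambda>i. \<integral>\<omega>. (norm (dF i (x (\<zeta> \<omega>) t i)))\<^sup>2 \<partial>M)"
        unfolding avg_def using t
        by (subst integral_scaleR_right, subst Bochner_Integration.integral_sum)
          (auto intro!: sq_integrableD(2) sq_integrable_dF_x)
      also have "\<dots> \<le> avg n (\<lambda>i. V1')" by (intro avg_mono expectation_dF_sqr t)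
      finally show "(\<integral>\<omega>. (norm (dFx t \<omega>))\<^sup>2 \<partial>M) \<le> V1'" using n by (simp add: avg_const)
      show "c * (\<integral>\<omega>. (norm (?\<xi>b t \<omega>))\<^sup>2 \<partial>M) \<le> (\<theta> + \<kappa>\<^sup>2) * (V1 / real n)"
        using c expectation_avg_noise[OF t] by (intro mult_mono) auto
    qed auto
    \<comment> \<open>The \<open>\<theta>\<close> share keeps its factor \<open>1 / n\<close>. The
      \<open>\<kappa>\<^sup>2\<close> share gives it up and joins
      \<open>\<kappa>\<^sup>2 * V1'\<close> to form \<open>\<kappa>\<^sup>2 * V2\<close>.\<close>
    also have "(\<theta> + \<kappa>\<^sup>2) * (V1 / real n) \<le> \<theta> * (V1 / real n) + \<kappa>\<^sup>2 * V1"
    proof -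
      have "V1 / real n \<le> V1 / 1" using n V_nonneg by (intro divide_left_mono) auto
      then have "\<kappa>\<^sup>2 * (V1 / real n) \<le> \<kappa>\<^sup>2 * V1" by (intro mult_left_mono) auto
      then show ?thesis by (simp only: distrib_right add_left_mono)
    qed
    finally show ?thesis by (simp add: V2_def distrib_left)
  qed
  have "(\<Sum>t<T. (\<integral>\<omega>. (norm (gradient ?F (?xb t \<omega>)))\<^sup>2 \<partial>M)) = (\<integral>\<omega>. (\<Sum>t<T. (norm (gradient ?F (?xb t \<omega>)))\<^sup>2) \<partial>M)"
    by (rule Bochner_Integration.integral_sum[symmetric]) (use int_grad in auto)
  also have "\<dots> \<le> (\<integral>\<omega>. 2 / \<gamma> * (?F x0 - ?F xmin) + (\<Sum>t<T. rhs t \<omega>) \<partial>M)"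
    by (rule integral_mono[OF _ _ tel]) (auto intro!: Bochner_Integration.integrable_sum int_grad int_rhs)
  also have "\<dots> = 2 / \<gamma> * (?F x0 - ?F xmin) + (\<integral>\<omega>. (\<Sum>t<T. rhs t \<omega>) \<partial>M)"
    by (subst Bochner_Integration.integral_add) (auto intro!: Bochner_Integration.integrable_sum int_rhs simp: prob_space)
  also have "(\<integral>\<omega>. (\<Sum>t<T. rhs t \<omega>) \<partial>M) = (\<Sum>t<T. (\<integral>\<omega>. rhs t \<omega> \<partial>M))"
    by (rule Bochner_Integration.integral_sum) (use int_rhs in auto)
  also have "\<dots> \<le> (\<Sum>t<T. 3 / 2 * (\<integral>\<omega>. (norm (bias t \<omega>))\<^sup>2 \<partial>M) + (\<kappa>\<^sup>2 * V2 + \<theta> * (V1 / real n)))"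
    using rhs by (intro sum_mono) auto
  also have "\<dots> = 3 / 2 * (\<Sum>t<T. (\<integral>\<omega>. (norm (bias t \<omega>))\<^sup>2 \<partial>M)) + real T * (\<kappa>\<^sup>2 * V2 + \<theta> * (V1 / real n))"
    by (simp add: sum.distrib sum_distrib_left)
  also have "\<dots> \<le> real T * (((q / (1 - q))\<^sup>2 + 1) * (2 * L\<^sup>2 * (real H)\<^sup>2 * R\<^sup>2)) + real T * (\<kappa>\<^sup>2 * V2 + \<theta> * (V1 / real n))"
    by (intro add_right_mono sum_expectation_bias)
  also have "\<kappa>\<^sup>2 * V2 = \<eta>\<^sup>2 * \<beta> ^ 4 * L\<^sup>2 * V2 / (1 - \<beta>) ^ 4"
  proof -
    have "\<kappa> = L * \<eta> * \<beta>\<^sup>2 / (1 - \<beta>)\<^sup>2" by (simp add: \<kappa>_def \<theta>_def \<gamma>_def power2_eq_square)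
    then show ?thesis by (simp add: power_divide power_mult_distrib)
  qed
  also have "\<theta> * (V1 / real n) = \<eta> * L * V1 / (real n * (1 - \<beta>))"
    by (simp add: \<theta>_def \<gamma>_def mult_ac)
  also have "2 / \<gamma> * (?F x0 - ?F xmin) = 2 * (1 - \<beta>) * (?F x0 - ?F xmin) / \<eta>"
    by (simp add: \<gamma>_def)
  finally show ?thesis by (simp add: distrib_left)
qed

end

theorem theorem2:
  fixes f :: "'a::euclidean_space \<Rightarrow> 'z \<Rightarrow> real"
    and Z :: "'z measure" and D :: "nat \<Rightarrow> 'z measure"
    and M :: "'w measure" and z :: "nat \<Rightarrow> nat \<Rightarrow> 'w \<Rightarrow> 'z"
    and C1 C2 :: "'a \<Rightarrow> 'a" and n H T :: nat
    and x0 xmin :: 'a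
    and \<beta> \<eta> \<delta>1 \<delta>2 L V1 V1' V2 :: real
    and x :: "nat \<Rightarrow> nat \<Rightarrow> 'w \<Rightarrow> 'a" and xbar :: "nat \<Rightarrow> 'w \<Rightarrow> 'a"
  defines "x \<equiv> (\<lambda>i t \<omega>. mcser_x f n C1 C2 H \<beta> \<eta> x0 (\<lambda>j s. z j s \<omega>) i t)"
    and "xbar \<equiv> (\<lambda>t \<omega>. avg n (\<lambda>i. x i t \<omega>))"
  assumes n: "n \<ge> 1" and T: "T \<ge> 1" and H: "H > 0"
    and \<beta>: "0 \<le> \<beta>" "\<beta> < 1" and L: "L > 0"
    and \<eta>: "0 < \<eta>" "\<eta> \<le> min (1 / 2) ((1 - \<beta>) / (2 * L))"
    and \<delta>1: "\<delta>1 \<in> {0<..1}" and \<delta>2: "\<delta>2 \<in> {0..1}"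
    and C1: "approx_compressor \<delta>1 C1" "C1 \<in> borel_measurable borel"
    and C2: "approx_compressor \<delta>2 C2" "C2 \<in> borel_measurable borel"
    \<comment> \<open>local data distributions\<close>
    and D: "\<And>i. i \<in> {1..n} \<Longrightarrow> prob_space (D i) \<and> sets (D i) = sets Z"
    and D_distinct: "inj_on D {1..n}"
    and f_integrable: "\<And>i y. i \<in> {1..n} \<Longrightarrow> integrable (D i) (f y)"
    and f_differentiable: "\<And>s y. s \<in> space Z \<Longrightarrow> (\<lambda>u. f u s) differentiable (at y)"
    and sgrad_unbiased: "\<And>i y. i \<in> {1..n} \<Longrightarrow>
      has_bochner_integral (D i) (sgrad f y) (gradient (local_obj f D i) y)"
    \<comment> \<open>independent sampling\<close>
    and M: "prob_space M"
    and z_indep: "prob_space.indep_vars M (\<lambda>_. Z) (\<lambda>(i, t). z i t) ({1..n} \<times> {1..T})"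
    and z_distr: "\<And>i t. i \<in> {1..n} \<Longrightarrow> t \<in> {1..T} \<Longrightarrow> distr M Z (z i t) = D i"
    \<comment> \<open>smoothness\<close>
    and smooth: "\<And>i. i \<in> {1..n} \<Longrightarrow> L_smooth L (local_obj f D i)"
    \<comment> \<open>stochastic gradients; the mean is taken over the fresh sample, given the current iterate\<close>
    and grad_variance: "\<And>i t. i \<in> {1..n} \<Longrightarrow> t \<in> {1..T} \<Longrightarrow>
      integrable M (\<lambda>\<omega>. (norm (sgrad f (x i (t - 1) \<omega>) (z i t \<omega>)
                              - gradient (local_obj f D i) (x i (t - 1) \<omega>)))\<^sup>2) \<and>
      (\<integral>\<omega>. (norm (sgrad f (x i (t - 1) \<omega>) (z i t \<omega>)
                  - gradient (local_obj f D i) (x i (t - 1) \<omega>)))\<^sup>2 \<partial>M) \<le> V1"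
    and grad_mean: "\<And>i t. i \<in> {1..n} \<Longrightarrow> t \<in> {1..T} \<Longrightarrow>
      (AE \<omega> in M. (norm (\<integral>s. sgrad f (x i (t - 1) \<omega>) s \<partial>D i))\<^sup>2 \<le> V1')"
    and V2: "V2 = V1 + V1'"
    \<comment> \<open>global minimum\<close>
    and xmin: "\<And>y. global_obj f D n xmin \<le> global_obj f D n y"
  shows "(\<forall>t\<in>{1..T}. integrable M (\<lambda>\<omega>. (norm (gradient (global_obj f D n) (xbar (t - 1) \<omega>)))\<^sup>2)) \<and>
    1 / real T * (\<Sum>t=1..T. \<integral>\<omega>. (norm (gradient (global_obj f D n) (xbar (t - 1) \<omega>)))\<^sup>2 \<partial>M)
      \<le> 2 * (1 - \<beta>) * (global_obj f D n (avg n (\<lambda>i. x0)) - global_obj f D n xmin) / (\<eta> * real T)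
        + \<eta>\<^sup>2 * \<beta> ^ 4 * L\<^sup>2 * V2 / (1 - \<beta>) ^ 4
        + \<eta> * L * V1 / (real n * (1 - \<beta>))
        + ((1 - \<delta>1) / (1 - sqrt (1 - \<delta>1))\<^sup>2 + 1)
          * (2 * (1 - \<delta>2) * \<eta>\<^sup>2 * (real H)\<^sup>2 * L\<^sup>2 * V2 / (1 - \<beta>)\<^sup>2) \<and>
    2 * (1 - \<beta>) * (global_obj f D n (avg n (\<lambda>i. x0)) - global_obj f D n xmin) / (\<eta> * real T)
        + \<eta>\<^sup>2 * \<beta> ^ 4 * L\<^sup>2 * V2 / (1 - \<beta>) ^ 4
        + \<eta> * L * V1 / (real n * (1 - \<beta>))
        + ((1 - \<delta>1) / (1 - sqrt (1 - \<delta>1))\<^sup>2 + 1)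
          * (2 * (1 - \<delta>2) * \<eta>\<^sup>2 * (real H)\<^sup>2 * L\<^sup>2 * V2 / (1 - \<beta>)\<^sup>2)
      \<le> 2 * (1 - \<beta>) * (global_obj f D n (avg n (\<lambda>i. x0)) - global_obj f D n xmin) / (\<eta> * real T)
        + \<eta>\<^sup>2 * \<beta> ^ 4 * L\<^sup>2 * V2 / (1 - \<beta>) ^ 4
        + \<eta> * L * V1 / (real n * (1 - \<beta>))
        + (4 * (1 - \<delta>1) / \<delta>1\<^sup>2 + 1)
          * (2 * (1 - \<delta>2) * \<eta>\<^sup>2 * (real H)\<^sup>2 * L\<^sup>2 * V2 / (1 - \<beta>)\<^sup>2)"
proof -
  interpret A: mcser_alg f n C1 C2 H \<beta> \<eta> x0 using n by unfold_locales
  have x: "x i t \<omega> = A.x (\<lambda>j s. z j s \<omega>) t i" for i t \<omega>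
    by (simp add: x_def mcser_x_def A.x_def)
  have xb: "xbar t \<omega> = avg n (A.x (\<lambda>j s. z j s \<omega>) t)" for t \<omega>
    by (simp add: xbar_def x)
  \<comment> \<open>Integrability is given for the local distributions only; any one worker
    suffices, since all of them share the measurable sets of \<open>Z\<close>.\<close>
  have f_measurable: "f y \<in> borel_measurable Z" for y
  proof -
    have 1: "1 \<in> {1..n}" using n by simp
    show ?thesis
      using borel_measurable_integrable[OF f_integrable[OF 1, of y]] D[OF 1]
      by (simp cong: measurable_cong_sets)
  qed
  interpret M: prob_space M by (rule M)
  interpret S: mcser_sampling M f n C1 C2 H \<beta> \<eta> x0 Z D z T \<delta>1 \<delta>2 L V1 V1'
  proof (intro mcser_sampling.intro mcser_sampling_axioms.intro)
    show "integrable M (\<lambda>\<omega>. (norm (A.g (\<lambda>j s. z j s \<omega>) t i - gradient (local_obj f D i) (A.x (\<lambda>j s. z j s \<omega>) t i)))\<^sup>2)"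
      "(\<integral>\<omega>. (norm (A.g (\<lambda>j s. z j s \<omega>) t i - gradient (local_obj f D i) (A.x (\<lambda>j s. z j s \<omega>) t i)))\<^sup>2 \<partial>M) \<le> V1"
      if "i \<in> {1..n}" "t < T" for i t
      using grad_variance[OF that(1), of "Suc t"] that(2) by (auto simp: A.g_def x)
    \<comment> \<open>The assumption bounds the mean over a fresh sample at the current iterate,
      which by unbiasedness is the local gradient there.\<close>
    show "AE \<omega> in M. (norm (gradient (local_obj f D i) (A.x (\<lambda>j s. z j s \<omega>) t i)))\<^sup>2 \<le> V1'"
      if "i \<in> {1..n}" "t < T" for i t
      using grad_mean[OF that(1), of "Suc t"] that(2)
      by (simp add: x has_bochner_integral_integral_eq[OF sgrad_unbiased[OF that(1)]])
    show "H > 0" "T \<ge> 1" "0 \<le> \<beta>" "\<beta> < 1" "L > 0" "0 < \<eta>" by fact+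
    show "\<eta> \<le> (1 - \<beta>) / (2 * L)" using \<eta>(2) by simp
    show "approx_compressor \<delta>1 C1" "C1 \<in> borel_measurable borel"
      "approx_compressor \<delta>2 C2" "C2 \<in> borel_measurable borel" by fact+
    show "0 < \<delta>1" using \<delta>1 by simp
    show "prob_space (D i)" "sets (D i) = sets Z" if "i \<in> {1..n}" for i using D[OF that] by auto
  qed (fact M A.mcser_alg_axioms f_measurable f_differentiable sgrad_unbiased z_indep z_distr smooth)+
  let ?F = "global_obj f D n" and ?q = "sqrt (1 - \<delta>1)"
  let ?K = "2 * (1 - \<delta>2) * \<eta>\<^sup>2 * (real H)\<^sup>2 * L\<^sup>2 * V2 / (1 - \<beta>)\<^sup>2"
  let ?a = "2 * (1 - \<beta>) * (?F (avg n (\<lambda>i. x0)) - ?F xmin) / (\<eta> * real T)"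
  let ?b = "\<eta>\<^sup>2 * \<beta> ^ 4 * L\<^sup>2 * V2 / (1 - \<beta>) ^ 4" and ?c = "\<eta> * L * V1 / (real n * (1 - \<beta>))"
  have V2': "S.V2 = V2" by (simp add: S.V2_def V2)
  have K0: "0 \<le> ?K" using \<delta>2 S.V_nonneg(3) by (simp add: V2')
  have K: "2 * L\<^sup>2 * (real H)\<^sup>2 * S.R\<^sup>2 = ?K"
    using \<delta>2 S.V_nonneg(3) by (simp add: S.R_def V2' power_mult_distrib power_divide)
  have q: "(S.q / (1 - S.q))\<^sup>2 = (1 - \<delta>1) / (1 - ?q)\<^sup>2"
    using \<delta>1 by (simp add: S.q_def power_divide)
  have "1 / real T * (\<Sum>t=1..T. \<integral>\<omega>. (norm (gradient ?F (xbar (t - 1) \<omega>)))\<^sup>2 \<partial>M)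
      = (\<Sum>t<T. \<integral>\<omega>. (norm (gradient ?F (avg n (A.x (\<lambda>j s. z j s \<omega>) t))))\<^sup>2 \<partial>M) / real T"
    by (simp add: sum.atLeast1_atMost_eq xb)
  also have "\<dots> \<le> (2 * (1 - \<beta>) * (?F x0 - ?F xmin) / \<eta> + real T * ?b + real T * ?c
      + real T * (((1 - \<delta>1) / (1 - ?q)\<^sup>2 + 1) * ?K)) / real T"
    using S.sum_expectation_gradient[OF xmin] unfolding V2' K q by (rule divide_right_mono) simp
  also have "\<dots> = ?a + ?b + ?c + ((1 - \<delta>1) / (1 - ?q)\<^sup>2 + 1) * ?K"
    using n T by (simp add: avg_const add_divide_distrib)
  finally have 1: "1 / real T * (\<Sum>t=1..T. \<integral>\<omega>. (norm (gradient ?F (xbar (t - 1) \<omega>)))\<^sup>2 \<partial>M)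
      \<le> ?a + ?b + ?c + ((1 - \<delta>1) / (1 - ?q)\<^sup>2 + 1) * ?K" .
  \<comment> \<open>Holds because \<open>(1 - \<delta>1 / 2)\<^sup>2\<close> exceeds
    \<open>1 - \<delta>1\<close> by \<open>\<delta>1\<^sup>2 / 4\<close>; it gives
    \<open>1 - ?q \<ge> \<delta>1 / 2\<close> and so the factor 4 of the second bound.\<close>
  have "?q \<le> 1 - \<delta>1 / 2"
    using \<delta>1 by (intro real_le_lsqrt) (auto simp: power2_eq_square algebra_simps)
  then have "(\<delta>1 / 2)\<^sup>2 \<le> (1 - ?q)\<^sup>2" using \<delta>1 by (intro power_mono) auto
  then have "(1 - \<delta>1) / (1 - ?q)\<^sup>2 \<le> (1 - \<delta>1) / (\<delta>1 / 2)\<^sup>2"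
    using \<delta>1 by (intro divide_left_mono) auto
  also have "\<dots> = 4 * (1 - \<delta>1) / \<delta>1\<^sup>2" by (simp add: power_divide)
  finally have "((1 - \<delta>1) / (1 - ?q)\<^sup>2 + 1) * ?K \<le> (4 * (1 - \<delta>1) / \<delta>1\<^sup>2 + 1) * ?K"
    using K0 by (intro mult_right_mono) auto
  moreover have "\<forall>t\<in>{1..T}. integrable M (\<lambda>\<omega>. (norm (gradient ?F (xbar (t - 1) \<omega>)))\<^sup>2)"
    unfolding xb by (intro ballI sq_integrableD(2) S.sq_integrable_grad S.sq_integrable_avg_x) auto
  ultimately show ?thesis using 1 by auto
qed

end
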